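(* Let $\mathcal A$ be an associative algebra over $\mathbb C$ with a modified double Poisson bracket $\{\!\!\{\_,\_\}\!\!\}$. Let $\mathcal M$ be a coassociative counital coalgebra equipped with a bilinear form $\nu$ and a trace element $\tau$ as in the context, and let $\{\_,\_\}^{\mathcal M}$ be the induced biderivation of the representation algebra $\mathcal A_{\mathcal M}$. Let $\mathbb C[\mathcal A_\tau]\subset\mathcal A_{\mathcal M}$ be the commutative algebra generated by $\mathcal A_\tau$. Then the restriction $$\{\_,\_\}^\tau:\ \mathbb C[\mathcal A_\tau]\otimes\mathbb C[\mathcal A_\tau]\to\mathbb C[\mathcal A_\tau]$$ of $\{\_,\_\}^{\mathcal M}$ is a Poisson bracket.
   Context: Everything is over $\mathbb C$. A modified double Poisson bracket on $\mathcal A$ is a linear map $\{\!\!\{\_\}\!\!\}:\mathcal A\otimes\mathcal A\to\mathcal A\otimes\mathcal A$, written $\{\!\!\{a,b\}\!\!\}=\{\!\!\{a,b\}\!\!\}'\otimes\{\!\!\{a,b\}\!\!\}''$ (sum suppressed), such that, with $\{\_,\_\}:=\mu\circ\{\!\!\{\_,\_\}\!\!\}$ ($\mu$ the multiplication), for all $a,b,c\in\mathcal A$: (1) $\{\!\!\{a,bc\}\!\!\}=(b\otimes 1)\{\!\!\{a,c\}\!\!\}+\{\!\!\{a,b\}\!\!\}(1\otimes c)$; (2) $\{\!\!\{ab,c\}\!\!\}=(1\otimes a)\{\!\!\{b,c\}\!\!\}+\{\!\!\{a,c\}\!\!\}(b\otimes 1)$; (3) $\{a,\{b,c\}\}-\{b,\{a,c\}\}=\{\{a,b\},c\}$;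 (4) $\{a,b\}+\{b,a\}\in[\mathcal A,\mathcal A]$, the span of commutators. Coalgebra data: $\mathcal M$ is a coassociative coalgebra with comultiplication $\Delta$ and counit $\epsilon$; iterated comultiplications are written $\Delta^m(\alpha)=\alpha^1\otimes\dots\otimes\alpha^m$ (sum suppressed). It is equipped with a bilinear form $\nu:\mathcal M\otimes\mathcal M\to\mathbb C$ such that $\nu(\alpha,\beta^2)\,\beta^1\otimes\beta^3=\nu(\beta,\alpha^2)\,\alpha^3\otimes\alpha^1$ for all $\alpha,\beta\in\mathcal M$, and an element $\tau\in\mathcal M$ with $\nu(\tau,\alpha)=\epsilon(\alpha)$ for all $\alpha\in\mathcal M$. The representation algebra $\mathcal A_{\mathcal M}$ is the commutative algebra generated by symbols $a_\alpha$ ($a\in\mathcal A$, $\alpha\in\mathcal M$) that are bilinear in $(a,\alpha)$, subject to $(ab)_\alpha=a_{\alpha^1}b_{\alpha^2}$. The induced bracket $\{\_,\_\}^{\mathcal M}$ is the biderivation of $\mathcal A_{\mathcal M}$ (Leibniz rule in each argument) with $\{a_\alpha,b_\beta\}^{\mathcal M}=\nu(\alpha,\beta^2)\,\{\!\!\{a,b\}\!\!\}'_{\beta^1}\{\!\!\{a,b\}\!\!\}''_{\beta^3}$. $\mathcal A_\tau=\{a_\tau: a\in\mathcal A\}\subset\mathcal A_{\mathcal M}$. *)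

theory Defs
  imports Complex_Main "HOL-Library.Poly_Mapping"
begin

section \<open>Complex vector spaces and algebras\<close>

class scaleC =
  fixes scaleC :: "complex \<Rightarrow> 'a \<Rightarrow> 'a" (infixr \<open>*\<^sub>C\<close> 75)

class complex_vector = scaleC + ab_group_add +
  assumes scaleC_add_right: "c *\<^sub>C (x + y) = c *\<^sub>C x + c *\<^sub>C y"
    and scaleC_add_left: "(c + d) *\<^sub>C x = c *\<^sub>C x + d *\<^sub>C x"
    and scaleC_scaleC: "c *\<^sub>C d *\<^sub>C x = (c * d) *\<^sub>C x"
    and scaleC_one: "1 *\<^sub>C x = x"

global_interpretation cvec: vector_space "scaleC :: complex \<Rightarrow> 'a \<Rightarrow> 'a::complex_vector"
  by unfold_locales (simp_all add: scaleC_add_right scaleC_add_left scaleC_scaleC scaleC_one)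

abbreviation clinear :: "('a::complex_vector \<Rightarrow> 'b::complex_vector) \<Rightarrow> bool" where
  "clinear \<equiv> Vector_Spaces.linear scaleC scaleC"

definition cbilinear :: "('a::complex_vector \<Rightarrow> 'b::complex_vector \<Rightarrow> 'c::complex_vector) \<Rightarrow> bool" where
  "cbilinear f \<longleftrightarrow> (\<forall>x. clinear (f x)) \<and> (\<forall>y. clinear (\<lambda>x. f x y))"

text \<open>Associative unital algebras.  The zero algebra is allowed, hence \<^class>\<open>ring\<close> with
  \<^class>\<open>monoid_mult\<close> instead of \<^class>\<open>ring_1\<close>, which would require \<open>0 \<noteq> 1\<close>.\<close>

class complex_algebra_1 = complex_vector + ring + monoid_mult +
  assumes mult_scaleC_left: "c *\<^sub>C x * y = c *\<^sub>C (x * y)"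
    and mult_scaleC_right: "x * c *\<^sub>C y = c *\<^sub>C (x * y)"

instantiation complex :: complex_algebra_1
begin

definition scaleC_complex :: "complex \<Rightarrow> complex \<Rightarrow> complex" where
  "scaleC_complex c x = c * x"

instance
  by standard (simp_all add: scaleC_complex_def algebra_simps)

end

lemma clinearI:
  fixes f :: "'a::complex_vector \<Rightarrow> 'b::complex_vector"
  assumes "\<And>x y. f (x + y) = f x + f y" "\<And>c x. f (c *\<^sub>C x) = c *\<^sub>C f x"
  shows "clinear f"
  using assms by unfold_locales

lemma clinear_add: "clinear f \<Longrightarrow> f (x + y) = f x + f y"
  by (simp add: Vector_Spaces.linear_def module_hom_iff)

lemma clinear_scaleC: "clinear f \<Longrightarrow> f (c *\<^sub>C x) = c *\<^sub>C f x"
  by (simp add: Vector_Spaces.linear_def module_hom_iff)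

lemma clinear_zero: "clinear f \<Longrightarrow> f 0 = 0"
  by (rule module_hom.zero[of scaleC scaleC]) (simp add: Vector_Spaces.linear_def)

lemma clinear_diff: "clinear f \<Longrightarrow> f (x - y) = f x - f y"
  by (rule module_hom.diff[of scaleC scaleC]) (simp add: Vector_Spaces.linear_def)

lemma clinear_uminus: "clinear f \<Longrightarrow> f (- x) = - f x"
  by (rule module_hom.neg[of scaleC scaleC]) (simp add: Vector_Spaces.linear_def)

lemma clinear_sum: "clinear f \<Longrightarrow> f (sum g A) = (\<Sum>x\<in>A. f (g x))"
  by (rule module_hom.sum[of scaleC scaleC]) (simp add: Vector_Spaces.linear_def)

lemma cbilinearI:
  assumes "\<And>x y y'. f x (y + y') = f x y + f x y'" "\<And>c x y. f x (c *\<^sub>C y) = c *\<^sub>C f x y"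
    and "\<And>x x' y. f (x + x') y = f x y + f x' y" "\<And>c x y. f (c *\<^sub>C x) y = c *\<^sub>C f x y"
  shows "cbilinear f"
  unfolding cbilinear_def using assms by (auto intro!: clinearI)

lemma cbilinearD:
  assumes "cbilinear f"
  shows "f x (y + y') = f x y + f x y'" "f x (c *\<^sub>C y) = c *\<^sub>C f x y"
    and "f (x + x') y = f x y + f x' y" "f (c *\<^sub>C x) y = c *\<^sub>C f x y"
proof -
  have 1: "clinear (f x)" and 2: "clinear (\<lambda>x. f x y)" for x y
    using assms by (simp_all add: cbilinear_def)
  show "f x (y + y') = f x y + f x y'" "f x (c *\<^sub>C y) = c *\<^sub>C f x y"
    using 1 by (simp_all add: clinear_add clinear_scaleC)
  show "f (x + x') y = f x y + f x' y" "f (c *\<^sub>C x) y = c *\<^sub>C f x y"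
    using clinear_add[OF 2] clinear_scaleC[OF 2] by simp_all
qed

section \<open>Tensor products over the complex numbers\<close>

instantiation poly_mapping :: (type, complex_vector) complex_vector
begin

definition scaleC_poly_mapping :: "complex \<Rightarrow> ('a \<Rightarrow>\<^sub>0 'b) \<Rightarrow> 'a \<Rightarrow>\<^sub>0 'b" where
  "scaleC_poly_mapping c = Poly_Mapping.map (scaleC c)"

lemma lookup_scaleC: "Poly_Mapping.lookup (c *\<^sub>C p) k = c *\<^sub>C Poly_Mapping.lookup (p :: 'a \<Rightarrow>\<^sub>0 'b) k"
  unfolding scaleC_poly_mapping_def by transfer (simp add: when_def)

instance
  by standard
    (simp_all add: poly_mapping_eq_iff fun_eq_iff lookup_scaleC lookup_add
      scaleC_add_right scaleC_add_left scaleC_scaleC scaleC_one)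

end

definition free_extend :: "('k \<Rightarrow> 'c::complex_vector) \<Rightarrow> ('k \<Rightarrow>\<^sub>0 complex) \<Rightarrow> 'c" where
  "free_extend f p = (\<Sum>k\<in>Poly_Mapping.keys p. Poly_Mapping.lookup p k *\<^sub>C f k)"

lemma free_extend_superset:
  assumes "finite A" "Poly_Mapping.keys p \<subseteq> A"
  shows "free_extend f p = (\<Sum>k\<in>A. Poly_Mapping.lookup p k *\<^sub>C f k)"
  unfolding free_extend_def
  by (rule sum.mono_neutral_left) (use assms in \<open>auto simp: in_keys_iff\<close>)

lemma free_extend_linear: "clinear (free_extend f)"
proof (rule clinearI)
  fix p q :: "'a \<Rightarrow>\<^sub>0 complex" and c :: complex
  let ?A = "Poly_Mapping.keys p \<union> Poly_Mapping.keys q"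
  have "Poly_Mapping.keys (p + q) \<subseteq> ?A"
    by (rule Poly_Mapping.keys_add)
  then have "free_extend f (p + q) = (\<Sum>k\<in>?A. Poly_Mapping.lookup (p + q) k *\<^sub>C f k)"
    by (intro free_extend_superset) auto
  also have "\<dots> = (\<Sum>k\<in>?A. Poly_Mapping.lookup p k *\<^sub>C f k) + (\<Sum>k\<in>?A. Poly_Mapping.lookup q k *\<^sub>C f k)"
    by (simp add: lookup_add scaleC_add_left sum.distrib)
  also have "\<dots> = free_extend f p + free_extend f q"
    by (subst (1 2) free_extend_superset[of ?A]) auto
  finally show "free_extend f (p + q) = free_extend f p + free_extend f q" .
  have "Poly_Mapping.keys (c *\<^sub>C p) \<subseteq> Poly_Mapping.keys p"
    by (auto simp: in_keys_iff lookup_scaleC)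
  then have "free_extend f (c *\<^sub>C p) = (\<Sum>k\<in>Poly_Mapping.keys p. Poly_Mapping.lookup (c *\<^sub>C p) k *\<^sub>C f k)"
    by (intro free_extend_superset) auto
  then show "free_extend f (c *\<^sub>C p) = c *\<^sub>C free_extend f p"
    by (simp add: lookup_scaleC free_extend_def cvec.scale_sum_right scaleC_scaleC scaleC_complex_def)
qed

lemma free_extend_single: "free_extend f (Poly_Mapping.single k 1) = f k"
  by (simp add: free_extend_def scaleC_one)

lemma free_extend_expand:
  "p = (\<Sum>k\<in>Poly_Mapping.keys p. Poly_Mapping.lookup p k *\<^sub>C Poly_Mapping.single k (1::complex))"
proof (rule poly_mapping_eqI)
  fix j
  show "Poly_Mapping.lookup p j = Poly_Mapping.lookup
    (\<Sum>k\<in>Poly_Mapping.keys p. Poly_Mapping.lookup p k *\<^sub>C Poly_Mapping.single k (1::complex)) j"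
    by (simp add: lookup_sum lookup_scaleC scaleC_complex_def lookup_single when_def
        in_keys_iff mult_ac if_distrib[where f="\<lambda>x. _ * x"] cong: if_cong)
qed

text \<open>The tensor product is the vector space freely generated by pairs modulo bilinearity.\<close>

inductive_set tensor_relators ::
  "('a::complex_vector \<times> 'b::complex_vector \<Rightarrow>\<^sub>0 complex) set" where
  "Poly_Mapping.single (x + x', y) 1 - Poly_Mapping.single (x, y) 1 - Poly_Mapping.single (x', y) 1
    \<in> tensor_relators"
| "Poly_Mapping.single (x, y + y') 1 - Poly_Mapping.single (x, y) 1 - Poly_Mapping.single (x, y') 1
    \<in> tensor_relators"
| "Poly_Mapping.single (c *\<^sub>C x, y) 1 - c *\<^sub>C Poly_Mapping.single (x, y) 1 \<in> tensor_relators"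
| "Poly_Mapping.single (x, c *\<^sub>C y) 1 - c *\<^sub>C Poly_Mapping.single (x, y) 1 \<in> tensor_relators"

quotient_type (overloaded) ('a, 'b) tensor =
  "'a::complex_vector \<times> 'b::complex_vector \<Rightarrow>\<^sub>0 complex" /
  "\<lambda>p q. p - q \<in> cvec.span tensor_relators"
proof (rule equivpI)
  show "reflp (\<lambda>p q. p - q \<in> cvec.span (tensor_relators :: ('a \<times> 'b \<Rightarrow>\<^sub>0 complex) set))"
    by (rule reflpI) (simp add: cvec.span_zero)
  show "symp (\<lambda>p q. p - q \<in> cvec.span (tensor_relators :: ('a \<times> 'b \<Rightarrow>\<^sub>0 complex) set))"
    by (rule sympI) (drule cvec.span_neg, simp)
  show "transp (\<lambda>p q. p - q \<in> cvec.span (tensor_relators :: ('a \<times> 'b \<Rightarrow>\<^sub>0 complex) set))"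
    by (rule transpI) (drule (1) cvec.span_add, simp)
qed

instantiation tensor :: (complex_vector, complex_vector) complex_vector
begin

lift_definition zero_tensor :: "('a, 'b) tensor" is 0 .

lift_definition plus_tensor :: "('a, 'b) tensor \<Rightarrow> ('a, 'b) tensor \<Rightarrow> ('a, 'b) tensor" is "(+)"
  by (drule (1) cvec.span_add) (simp add: algebra_simps)

lift_definition uminus_tensor :: "('a, 'b) tensor \<Rightarrow> ('a, 'b) tensor" is uminus
  by (drule cvec.span_neg) simp

lift_definition minus_tensor :: "('a, 'b) tensor \<Rightarrow> ('a, 'b) tensor \<Rightarrow> ('a, 'b) tensor" is "(-)"
proof -
  fix p p' q q' :: "'a \<times> 'b \<Rightarrow>\<^sub>0 complex"
  assume "p - p' \<in> cvec.span tensor_relators" "q - q' \<in> cvec.span tensor_relators"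
  then have "(p - p') - (q - q') \<in> cvec.span tensor_relators"
    by (rule cvec.span_diff)
  then show "p - q - (p' - q') \<in> cvec.span tensor_relators"
    by (simp add: algebra_simps)
qed

lift_definition scaleC_tensor :: "complex \<Rightarrow> ('a, 'b) tensor \<Rightarrow> ('a, 'b) tensor" is "(*\<^sub>C)"
proof -
  fix c and p p' :: "'a \<times> 'b \<Rightarrow>\<^sub>0 complex"
  assume "p - p' \<in> cvec.span tensor_relators"
  then have "c *\<^sub>C (p - p') \<in> cvec.span tensor_relators"
    by (rule cvec.span_scale)
  then show "c *\<^sub>C p - c *\<^sub>C p' \<in> cvec.span tensor_relators"
    by (simp add: cvec.scale_right_diff_distrib)
qed

instance
proof
  fix x y z :: "('a, 'b) tensor" and c d :: complex
  note z = cvec.span_zero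
  show "x + y + z = x + (y + z)" "x + y = y + x" "0 + x = x" "- x + x = 0" "x - y = x + - y"
    by (transfer; simp add: z algebra_simps)+
  show "c *\<^sub>C (x + y) = c *\<^sub>C x + c *\<^sub>C y" "(c + d) *\<^sub>C x = c *\<^sub>C x + d *\<^sub>C x"
    "c *\<^sub>C d *\<^sub>C x = (c * d) *\<^sub>C x" "1 *\<^sub>C x = x"
    by (transfer; simp add: z scaleC_add_right scaleC_add_left scaleC_scaleC scaleC_one)+
qed

end

lift_definition tensor_pure :: "'a::complex_vector \<Rightarrow> 'b::complex_vector \<Rightarrow> ('a, 'b) tensor"
    (infixl \<open>\<otimes>\<close> 76)
  is "\<lambda>x y. Poly_Mapping.single (x, y) 1" .

text \<open>For bilinear \<open>f\<close>, the linear map sending \<open>x \<otimes> y\<close> to \<open>f x y\<close>; meaningless otherwise.\<close>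

definition tensor_lift ::
  "('a::complex_vector \<Rightarrow> 'b::complex_vector \<Rightarrow> 'c::complex_vector) \<Rightarrow> ('a, 'b) tensor \<Rightarrow> 'c" where
  "tensor_lift f t = free_extend (\<lambda>(x, y). f x y) (rep_tensor t)"

lemma cbilinear_tensor_pure: "cbilinear (\<otimes>)"
proof (rule cbilinearI)
  show "x \<otimes> (y + y') = x \<otimes> y + x \<otimes> y'" for x :: 'a and y y' :: 'b
    by transfer (simp add: cvec.span_base tensor_relators.intros(2) flip: diff_diff_eq)
  show "(x + x') \<otimes> y = x \<otimes> y + x' \<otimes> y" for x x' :: 'a and y :: 'b
    by transfer (simp add: cvec.span_base tensor_relators.intros(1) flip: diff_diff_eq)
  show "x \<otimes> (c *\<^sub>C y) = c *\<^sub>C (x \<otimes> y)" for c and x :: 'a and y :: 'b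
    by transfer (simp add: cvec.span_base tensor_relators.intros(4))
  show "(c *\<^sub>C x) \<otimes> y = c *\<^sub>C (x \<otimes> y)" for c and x :: 'a and y :: 'b
    by transfer (simp add: cvec.span_base tensor_relators.intros(3))
qed

lemma free_extend_tensor_span:
  fixes f :: "'a::complex_vector \<Rightarrow> 'b::complex_vector \<Rightarrow> 'c::complex_vector"
  assumes f: "cbilinear f" and p: "p \<in> cvec.span tensor_relators"
  shows "free_extend (\<lambda>(x, y). f x y) p = 0"
proof -
  let ?F = "free_extend (\<lambda>(x, y). f x y)"
  have lin: "clinear ?F"
    by (rule free_extend_linear)
  have zero: "?F r = 0" if "r \<in> tensor_relators" for r
    using that by cases
      (simp_all add: clinear_diff[OF lin] clinear_scaleC[OF lin] free_extend_single cbilinearD[OF f])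
  show ?thesis
    using p by (induction rule: cvec.span_induct_alt)
      (simp_all add: clinear_add[OF lin] clinear_scaleC[OF lin] clinear_zero[OF lin] zero)
qed

lemma tensor_lift_abs:
  assumes "cbilinear f"
  shows "tensor_lift f (abs_tensor p) = free_extend (\<lambda>(x, y). f x y) p"
proof -
  have "rep_tensor (abs_tensor p) - p \<in> cvec.span tensor_relators"
    by (rule Quotient3_rep_abs[OF Quotient3_tensor]) (simp add: cvec.span_zero)
  from free_extend_tensor_span[OF assms this] show ?thesis
    by (simp add: tensor_lift_def clinear_diff[OF free_extend_linear])
qed

lemma tensor_lift_pure:
  assumes "cbilinear f"
  shows "tensor_lift f (x \<otimes> y) = f x y"
  unfolding tensor_pure.abs_eq by (simp add: tensor_lift_abs[OF assms] free_extend_single)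

lemma clinear_tensor_lift:
  fixes f :: "'a::complex_vector \<Rightarrow> 'b::complex_vector \<Rightarrow> 'c::complex_vector"
  assumes "cbilinear f"
  shows "clinear (tensor_lift f)"
proof (rule clinearI)
  fix s t :: "('a, 'b) tensor" and c :: complex
  obtain p where s: "s = abs_tensor p"
    by (rule Quotient3_abs_rep[OF Quotient3_tensor, symmetric, THEN that])
  obtain q where t: "t = abs_tensor q"
    by (rule Quotient3_abs_rep[OF Quotient3_tensor, symmetric, THEN that])
  show "tensor_lift f (s + t) = tensor_lift f s + tensor_lift f t"
    unfolding s t plus_tensor.abs_eq
    by (simp add: tensor_lift_abs[OF assms] clinear_add[OF free_extend_linear])
  show "tensor_lift f (c *\<^sub>C s) = c *\<^sub>C tensor_lift f s"
    unfolding s scaleC_tensor.abs_eq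
    by (simp add: tensor_lift_abs[OF assms] clinear_scaleC[OF free_extend_linear])
qed

lemma tensor_induct [case_names pure add]:
  fixes t :: "('a::complex_vector, 'b::complex_vector) tensor"
  assumes "\<And>x y. P (x \<otimes> y)" and "\<And>s t. P s \<Longrightarrow> P t \<Longrightarrow> P (s + t)"
  shows "P t"
proof -
  have sc: "c *\<^sub>C (x \<otimes> y) = (c *\<^sub>C x) \<otimes> y" for c and x :: 'a and y :: 'b
    by (simp add: cbilinearD[OF cbilinear_tensor_pure])
  have zero: "P 0"
    using assms(1)[of 0 0] sc[of 0 0 0] by simp
  have abs_single: "abs_tensor (Poly_Mapping.single (x, y) 1) = x \<otimes> y" for x :: 'a and y :: 'b
    by (simp add: tensor_pure.abs_eq)
  have abs_sum: "abs_tensor (sum g A) = (\<Sum>k\<in>A. abs_tensor (g k))"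
    if "finite A" for g :: "'a \<times> 'b \<Rightarrow> 'a \<times> 'b \<Rightarrow>\<^sub>0 complex" and A
    using that by induction (simp_all add: zero_tensor.abs_eq[symmetric] plus_tensor.abs_eq[symmetric])
  have P_sum: "P (sum g A)" if "finite A" "\<And>k. k \<in> A \<Longrightarrow> P (g k)"
    for g :: "'a \<times> 'b \<Rightarrow> ('a, 'b) tensor" and A
    using that by induction (auto simp: zero assms(2))
  obtain p where t: "t = abs_tensor p"
    by (rule Quotient3_abs_rep[OF Quotient3_tensor, symmetric, THEN that])
  have "abs_tensor p =
      abs_tensor (\<Sum>k\<in>Poly_Mapping.keys p. Poly_Mapping.lookup p k *\<^sub>C Poly_Mapping.single k 1)"
    using free_extend_expand[of p] by (rule arg_cong)
  then have "t = (\<Sum>k\<in>Poly_Mapping.keys p. Poly_Mapping.lookup p k *\<^sub>C abs_tensor (Poly_Mapping.single k 1))"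
    by (simp only: t abs_sum finite_keys scaleC_tensor.abs_eq)
  also have "P \<dots>"
    by (rule P_sum) (auto simp: abs_single sc assms(1))
  finally show ?thesis .
qed

lemma clinear_tensor_eqI:
  assumes "clinear f" "clinear g" "\<And>x y. f (x \<otimes> y) = g (x \<otimes> y)"
  shows "f t = g t"
  by (induction t rule: tensor_induct) (simp_all add: assms clinear_add)

text \<open>The algebra structure \<open>(a \<otimes> b)(c \<otimes> d) = ac \<otimes> bd\<close> on a tensor product of algebras.\<close>

instantiation tensor :: (complex_algebra_1, complex_algebra_1) complex_algebra_1
begin

definition one_tensor :: "('a, 'b) tensor" where
  "one_tensor = 1 \<otimes> 1"

definition times_tensor :: "('a, 'b) tensor \<Rightarrow> ('a, 'b) tensor \<Rightarrow> ('a, 'b) tensor" where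
  "times_tensor s t = tensor_lift (\<lambda>a b. tensor_lift (\<lambda>c d. (a * c) \<otimes> (b * d)) t) s"

lemma times_tensor_aux1: "cbilinear (\<lambda>c d. ((a::'a) * c) \<otimes> ((b::'b) * d))"
  by (rule cbilinearI)
    (simp_all add: distrib_left mult_scaleC_right cbilinearD[OF cbilinear_tensor_pure])

lemma times_tensor_aux2: "cbilinear (\<lambda>a b. tensor_lift (\<lambda>c d. ((a::'a) * c) \<otimes> ((b::'b) * d)) t)"
proof -
  let ?L = "\<lambda>a b. tensor_lift (\<lambda>c d. ((a::'a) * c) \<otimes> ((b::'b) * d))"
  note lift = tensor_lift_pure[OF times_tensor_aux1]
  note lift_add = clinear_add[OF clinear_tensor_lift[OF times_tensor_aux1]]
  note bil = cbilinearD[OF cbilinear_tensor_pure]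
  show ?thesis
  proof (rule cbilinearI)
    fix a a' :: 'a and b b' :: 'b and c :: complex
    show "?L a (b + b') t = ?L a b t + ?L a b' t"
    proof (induction t rule: tensor_induct)
      case (pure x y)
      show ?case unfolding lift by (simp add: distrib_right bil)
    next
      case (add r s)
      then show ?case unfolding lift_add by (simp add: ac_simps)
    qed
    show "?L (a + a') b t = ?L a b t + ?L a' b t"
    proof (induction t rule: tensor_induct)
      case (pure x y)
      show ?case unfolding lift by (simp add: distrib_right bil)
    next
      case (add r s)
      then show ?case unfolding lift_add by (simp add: ac_simps)
    qed
    show "?L a (c *\<^sub>C b) t = c *\<^sub>C ?L a b t"
    proof (induction t rule: tensor_induct)
      case (pure x y)
      show ?case unfolding lift by (simp add: mult_scaleC_left bil)
    next
      case (add r s)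
      then show ?case unfolding lift_add by (simp add: scaleC_add_right)
    qed
    show "?L (c *\<^sub>C a) b t = c *\<^sub>C ?L a b t"
    proof (induction t rule: tensor_induct)
      case (pure x y)
      show ?case unfolding lift by (simp add: mult_scaleC_left bil)
    next
      case (add r s)
      then show ?case unfolding lift_add by (simp add: scaleC_add_right)
    qed
  qed
qed

lemma times_tensor_pure: "(a \<otimes> b) * (c \<otimes> d) = ((a::'a) * c) \<otimes> ((b::'b) * d)"
  unfolding times_tensor_def tensor_lift_pure[OF times_tensor_aux2]
  by (rule tensor_lift_pure[OF times_tensor_aux1])

lemma times_tensor_cbilinear: "cbilinear ((*) :: ('a, 'b) tensor \<Rightarrow> _)"
proof (rule cbilinearI)
  fix s t u :: "('a, 'b) tensor" and c :: complex
  show "(s + t) * u = s * u + t * u" "(c *\<^sub>C s) * u = c *\<^sub>C (s * u)"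
    unfolding times_tensor_def
    by (simp_all add: clinear_add[OF clinear_tensor_lift[OF times_tensor_aux2]]
        clinear_scaleC[OF clinear_tensor_lift[OF times_tensor_aux2]])
  have add: "(s + t) * u = s * u + t * u" for s t u :: "('a, 'b) tensor"
    unfolding times_tensor_def
    by (simp add: clinear_add[OF clinear_tensor_lift[OF times_tensor_aux2]])
  have pure: "(a \<otimes> b) * t = tensor_lift (\<lambda>c d. (a * c) \<otimes> (b * d)) t" for a :: 'a and b :: 'b and t
    by (simp add: times_tensor_def tensor_lift_pure[OF times_tensor_aux2])
  show "u * (s + t) = u * s + u * t"
    by (induction u rule: tensor_induct)
      (simp_all add: add pure clinear_add[OF clinear_tensor_lift[OF times_tensor_aux1]] ac_simps)
  show "u * (c *\<^sub>C s) = c *\<^sub>C (u * s)"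
    by (induction u rule: tensor_induct)
      (simp_all add: add pure clinear_scaleC[OF clinear_tensor_lift[OF times_tensor_aux1]] scaleC_add_right)
qed

instance
proof
  fix s t u :: "('a, 'b) tensor" and c :: complex
  note bil = cbilinearD[OF times_tensor_cbilinear]
  show "(s + t) * u = s * u + t * u" "s * (t + u) = s * t + s * u"
    "(c *\<^sub>C s) * t = c *\<^sub>C (s * t)" "s * (c *\<^sub>C t) = c *\<^sub>C (s * t)"
    by (simp_all add: bil)
  show "1 * s = s" "s * 1 = s"
    by (induction s rule: tensor_induct) (simp_all add: bil one_tensor_def times_tensor_pure)
  show "s * t * u = s * (t * u)"
  proof (induction s rule: tensor_induct)
    case (pure a b)
    show ?case
    proof (induction t rule: tensor_induct)
      case (pure c d)
      show ?case
        by (induction u rule: tensor_induct) (simp_all add: bil times_tensor_pure mult.assoc)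
    qed (simp add: bil)
  qed (simp add: bil)
qed

end

definition tensor_map ::
  "('a::complex_vector \<Rightarrow> 'c::complex_vector) \<Rightarrow> ('b::complex_vector \<Rightarrow> 'd::complex_vector)
    \<Rightarrow> ('a, 'b) tensor \<Rightarrow> ('c, 'd) tensor" where
  "tensor_map f g = tensor_lift (\<lambda>x y. f x \<otimes> g y)"

definition tensor_assoc ::
  "(('a::complex_vector, 'b::complex_vector) tensor, 'c::complex_vector) tensor
    \<Rightarrow> ('a, ('b, 'c) tensor) tensor" where
  "tensor_assoc = tensor_lift (\<lambda>t z. tensor_lift (\<lambda>x y. x \<otimes> (y \<otimes> z)) t)"

definition tensor3_lift ::
  "('a::complex_vector \<Rightarrow> 'b::complex_vector \<Rightarrow> 'c::complex_vector \<Rightarrow> 'd::complex_vector)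
    \<Rightarrow> ('a, ('b, 'c) tensor) tensor \<Rightarrow> 'd" where
  "tensor3_lift f = tensor_lift (\<lambda>x. tensor_lift (f x))"

section \<open>Coalgebras\<close>

text \<open>The superclass \<^class>\<open>complex_vector\<close> is inferred from the sort constraint on \<open>'a\<close>;
  naming it as a superclass instead would leave \<open>'a\<close> without the sort that \<open>tensor_lift\<close> needs.\<close>

class coalgebra =
  fixes comult :: "'a::complex_vector \<Rightarrow> ('a, 'a) tensor"
    and counit :: "'a::complex_vector \<Rightarrow> complex"
  assumes clinear_comult: "clinear comult"
    and clinear_counit: "clinear counit"
    and coassoc: "tensor_assoc (tensor_map comult id (comult x)) = tensor_map id comult (comult x)"
    and counit_left: "tensor_lift (\<lambda>y z. counit y *\<^sub>C z) (comult x) = x"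
    and counit_right: "tensor_lift (\<lambda>y z. counit z *\<^sub>C y) (comult x) = x"

definition comult3 :: "'m::coalgebra \<Rightarrow> ('m, ('m, 'm) tensor) tensor" where
  "comult3 \<alpha> = tensor_map id comult (comult \<alpha>)"

text \<open>\<open>\<nu>(\<alpha>, \<beta>\<^sup>2) \<beta>\<^sup>1 \<otimes> \<beta>\<^sup>3 = \<nu>(\<beta>, \<alpha>\<^sup>2) \<alpha>\<^sup>3 \<otimes> \<alpha>\<^sup>1\<close>, where \<open>comult3 \<alpha> = \<alpha>\<^sup>1 \<otimes> \<alpha>\<^sup>2 \<otimes> \<alpha>\<^sup>3\<close>.\<close>

definition balanced_form :: "('m::coalgebra \<Rightarrow> 'm \<Rightarrow> complex) \<Rightarrow> bool" where
  "balanced_form \<nu> \<longleftrightarrow> cbilinear \<nu> \<and>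
    (\<forall>\<alpha> \<beta>. tensor3_lift (\<lambda>\<beta>1 \<beta>2 \<beta>3. \<nu> \<alpha> \<beta>2 *\<^sub>C (\<beta>1 \<otimes> \<beta>3)) (comult3 \<beta>) =
           tensor3_lift (\<lambda>\<alpha>1 \<alpha>2 \<alpha>3. \<nu> \<beta> \<alpha>2 *\<^sub>C (\<alpha>3 \<otimes> \<alpha>1)) (comult3 \<alpha>))"

definition trace_element :: "('m::coalgebra \<Rightarrow> 'm \<Rightarrow> complex) \<Rightarrow> 'm \<Rightarrow> bool" where
  "trace_element \<nu> \<tau> \<longleftrightarrow> (\<forall>\<alpha>. \<nu> \<tau> \<alpha> = counit \<alpha>)"

section \<open>Modified double Poisson brackets\<close>

definition mult_bracket ::
  "(('a::complex_algebra_1, 'a) tensor \<Rightarrow> ('a, 'a) tensor) \<Rightarrow> 'a \<Rightarrow> 'a \<Rightarrow> 'a" where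
  "mult_bracket D a b = tensor_lift (*) (D (a \<otimes> b))"

definition modified_double_poisson ::
  "(('a::complex_algebra_1, 'a) tensor \<Rightarrow> ('a, 'a) tensor) \<Rightarrow> bool" where
  "modified_double_poisson D \<longleftrightarrow> clinear D \<and>
    (\<forall>a b c. D (a \<otimes> (b * c)) = (b \<otimes> 1) * D (a \<otimes> c) + D (a \<otimes> b) * (1 \<otimes> c)) \<and>
    (\<forall>a b c. D ((a * b) \<otimes> c) = (1 \<otimes> a) * D (b \<otimes> c) + D (a \<otimes> c) * (b \<otimes> 1)) \<and>
    (\<forall>a b c. mult_bracket D a (mult_bracket D b c) - mult_bracket D b (mult_bracket D a c) =
             mult_bracket D (mult_bracket D a b) c) \<and>
    (\<forall>a b. mult_bracket D a b + mult_bracket D b a \<in> cvec.span {x * y - y * x | x y. True})"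

section \<open>Representation algebras\<close>

text \<open>The locale \<^locale>\<open>module\<close> is deliberately not interpreted globally for a ring acting on itself:
  its simplification rule \<open>a * (b * x) = (a * b) * x\<close> loops against associativity.\<close>

lemma module_cring: "module ((*) :: 'r \<Rightarrow> 'r \<Rightarrow> 'r::comm_ring_1)"
  by unfold_locales (simp_all add: algebra_simps)

abbreviation generated_ideal :: "'r::comm_ring_1 set \<Rightarrow> 'r set" where
  "generated_ideal \<equiv> module.span (*)"

lemmas ideal_zero = module.span_zero[OF module_cring]
lemmas ideal_add = module.span_add[OF module_cring]
lemmas ideal_diff = module.span_diff[OF module_cring]
lemmas ideal_neg = module.span_neg[OF module_cring]
lemmas ideal_mult = module.span_scale[OF module_cring]
lemmas ideal_induct [consumes 1, case_names base step] = module.span_induct_alt[OF module_cring]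

text \<open>Polynomials with complex coefficients in variables indexed by pairs.\<close>

type_synonym ('a, 'm) rep_poly = "('a \<times> 'm \<Rightarrow>\<^sub>0 nat) \<Rightarrow>\<^sub>0 complex"

definition rep_var :: "'a \<Rightarrow> 'm \<Rightarrow> ('a, 'm) rep_poly" where
  "rep_var a \<alpha> = Poly_Mapping.single (Poly_Mapping.single (a, \<alpha>) 1) 1"

text \<open>In the last clause every presentation of \<open>comult \<alpha>\<close> as a finite sum of pure tensors is used,
  so that no choice is involved.  The unit of the algebra is not tied to that of \<open>'a\<close>:
  there is no relation between \<open>1\<^sub>\<alpha>\<close> and \<open>\<epsilon>(\<alpha>)\<close>.\<close>

inductive_set rep_relators :: "('a::complex_algebra_1, 'm::coalgebra) rep_poly set" where
  "rep_var (a + b) \<alpha> - rep_var a \<alpha> - rep_var b \<alpha> \<in> rep_relators"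
| "rep_var (c *\<^sub>C a) \<alpha> - c *\<^sub>C rep_var a \<alpha> \<in> rep_relators"
| "rep_var a (\<alpha> + \<beta>) - rep_var a \<alpha> - rep_var a \<beta> \<in> rep_relators"
| "rep_var a (c *\<^sub>C \<alpha>) - c *\<^sub>C rep_var a \<alpha> \<in> rep_relators"
| "comult \<alpha> = (\<Sum>(\<alpha>1, \<alpha>2)\<leftarrow>xs. \<alpha>1 \<otimes> \<alpha>2) \<Longrightarrow>
    rep_var (a * b) \<alpha> - (\<Sum>(\<alpha>1, \<alpha>2)\<leftarrow>xs. rep_var a \<alpha>1 * rep_var b \<alpha>2) \<in> rep_relators"

lemma rep_relators_const:
  assumes "p \<in> generated_ideal (rep_relators :: ('a::complex_algebra_1, 'm::coalgebra) rep_poly set)"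
  shows "Poly_Mapping.lookup p 0 = 0"
proof -
  have mult: "Poly_Mapping.lookup (p * q) 0 = 0" if "Poly_Mapping.lookup q 0 = 0"
    for p q :: "('a, 'm) rep_poly"
  proof -
    have snd_zero: "y = 0" if "x + y = 0" for x y :: "'a \<times> 'm \<Rightarrow>\<^sub>0 nat"
    proof (rule poly_mapping_eqI)
      fix k
      have "Poly_Mapping.lookup (x + y) k = 0"
        by (simp add: that)
      then show "Poly_Mapping.lookup y k = Poly_Mapping.lookup 0 k"
        by (simp add: lookup_add)
    qed
    have "0 \<notin> Poly_Mapping.keys (p * q)"
    proof
      assume "0 \<in> Poly_Mapping.keys (p * q)"
      with Poly_Mapping.keys_mult[of p q] obtain x y
        where "0 = x + y" "y \<in> Poly_Mapping.keys q"
        by blast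
      with snd_zero[of x y] that show False
        by (simp add: in_keys_iff)
    qed
    then show ?thesis
      by (simp add: in_keys_iff)
  qed
  have var: "Poly_Mapping.lookup (rep_var a \<alpha>) 0 = 0" for a :: 'a and \<alpha> :: 'm
  proof -
    have "Poly_Mapping.lookup (Poly_Mapping.single (a, \<alpha>) (1::nat)) (a, \<alpha>) \<noteq> 0"
      by simp
    then have "Poly_Mapping.single (a, \<alpha>) (1::nat) \<noteq> 0"
      by (metis lookup_zero)
    then show ?thesis
      by (simp add: rep_var_def lookup_single when_def)
  qed
  have sums: "Poly_Mapping.lookup (\<Sum>(\<alpha>1, \<alpha>2)\<leftarrow>xs. rep_var a \<alpha>1 * rep_var b \<alpha>2) 0 = 0"
    for xs :: "('m \<times> 'm) list" and a b :: 'a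
    by (induction xs) (auto simp: lookup_add mult var)
  have rel: "Poly_Mapping.lookup r 0 = 0" if "r \<in> rep_relators" for r :: "('a, 'm) rep_poly"
    using that by cases (simp_all add: lookup_minus lookup_scaleC scaleC_complex_def var sums)
  show ?thesis
    using assms
  proof (induction rule: ideal_induct)
    case (step c x y)
    then show ?case
      using mult[OF rel, of x c] by (simp add: lookup_add)
  qed simp
qed

quotient_type (overloaded) ('a, 'm) rep_alg =
  "('a::complex_algebra_1, 'm::coalgebra) rep_poly" /
  "\<lambda>p q. p - q \<in> generated_ideal rep_relators"
proof (rule equivpI)
  let ?I = "generated_ideal (rep_relators :: ('a, 'm) rep_poly set)"
  show "reflp (\<lambda>p q. p - q \<in> ?I)"
    by (rule reflpI) (simp add: ideal_zero)
  show "symp (\<lambda>p q. p - q \<in> ?I)"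
    by (rule sympI) (drule ideal_neg, simp)
  show "transp (\<lambda>p q. p - q \<in> ?I)"
    by (rule transpI) (drule (1) ideal_add, simp)
qed

lemma scaleC_rep_poly: "c *\<^sub>C p = Poly_Mapping.single 0 c * (p :: ('a, 'm) rep_poly)"
  unfolding scaleC_poly_mapping_def mult_map_scale_conv_mult[symmetric]
  by (simp add: scaleC_complex_def[abs_def])

instantiation rep_alg :: (complex_algebra_1, coalgebra) "{comm_ring_1, complex_algebra_1}"
begin

lift_definition zero_rep_alg :: "('a, 'b) rep_alg" is 0 .

lift_definition one_rep_alg :: "('a, 'b) rep_alg" is 1 .

lift_definition plus_rep_alg :: "('a, 'b) rep_alg \<Rightarrow> ('a, 'b) rep_alg \<Rightarrow> ('a, 'b) rep_alg" is "(+)"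
  by (drule (1) ideal_add) (simp add: algebra_simps)

lift_definition uminus_rep_alg :: "('a, 'b) rep_alg \<Rightarrow> ('a, 'b) rep_alg" is uminus
  by (drule ideal_neg) simp

lift_definition minus_rep_alg :: "('a, 'b) rep_alg \<Rightarrow> ('a, 'b) rep_alg \<Rightarrow> ('a, 'b) rep_alg" is "(-)"
proof -
  fix p p' q q' :: "('a, 'b) rep_poly"
  assume "p - p' \<in> generated_ideal rep_relators" "q - q' \<in> generated_ideal rep_relators"
  then have "(p - p') - (q - q') \<in> generated_ideal rep_relators"
    by (rule ideal_diff)
  then show "p - q - (p' - q') \<in> generated_ideal rep_relators"
    by (simp add: algebra_simps)
qed

lift_definition times_rep_alg :: "('a, 'b) rep_alg \<Rightarrow> ('a, 'b) rep_alg \<Rightarrow> ('a, 'b) rep_alg" is "(*)"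
proof -
  fix p p' q q' :: "('a, 'b) rep_poly"
  assume "p - p' \<in> generated_ideal rep_relators" "q - q' \<in> generated_ideal rep_relators"
  then have "q * (p - p') + p' * (q - q') \<in> generated_ideal rep_relators"
    by (intro ideal_add ideal_mult)
  then show "p * q - p' * q' \<in> generated_ideal rep_relators"
    by (simp add: algebra_simps)
qed

lift_definition scaleC_rep_alg :: "complex \<Rightarrow> ('a, 'b) rep_alg \<Rightarrow> ('a, 'b) rep_alg" is "(*\<^sub>C)"
proof -
  fix c and p p' :: "('a, 'b) rep_poly"
  assume "p - p' \<in> generated_ideal rep_relators"
  then have "Poly_Mapping.single 0 c * (p - p') \<in> generated_ideal rep_relators"
    by (rule ideal_mult)
  then show "c *\<^sub>C p - c *\<^sub>C p' \<in> generated_ideal rep_relators"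
    by (simp add: scaleC_rep_poly right_diff_distrib)
qed

instance
proof
  show "(0::('a, 'b) rep_alg) \<noteq> 1"
  proof transfer
    show "(0::('a, 'b) rep_poly) - 1 \<notin> generated_ideal rep_relators"
      using rep_relators_const[of "0 - 1 :: ('a, 'b) rep_poly"] by (auto simp: lookup_minus)
  qed
next
  fix x y z :: "('a, 'b) rep_alg" and c d :: complex
  note z = ideal_zero
  show "x + y + z = x + (y + z)" "x + y = y + x" "0 + x = x" "- x + x = 0" "x - y = x + - y"
    by (transfer; simp add: z algebra_simps)+
  show "x * y * z = x * (y * z)" "1 * x = x" "x * 1 = x"
    by (transfer; simp add: z mult.assoc)+
  show "x * y = y * x"
    by transfer (simp add: z mult.commute)
  show "(x + y) * z = x * z + y * z" "x * (y + z) = x * y + x * z"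
    by (transfer; simp add: z distrib_left distrib_right)+
  show "c *\<^sub>C (x + y) = c *\<^sub>C x + c *\<^sub>C y" "(c + d) *\<^sub>C x = c *\<^sub>C x + d *\<^sub>C x"
    "c *\<^sub>C d *\<^sub>C x = (c * d) *\<^sub>C x" "1 *\<^sub>C x = x"
    by (transfer; simp add: z scaleC_add_right scaleC_add_left scaleC_scaleC scaleC_one)+
  show "c *\<^sub>C x * y = c *\<^sub>C (x * y)" "x * c *\<^sub>C y = c *\<^sub>C (x * y)"
    by (transfer; simp add: z scaleC_rep_poly mult.left_commute mult.assoc)+
qed

end

text \<open>The generator \<open>a\<^sub>\<alpha>\<close>.\<close>

lift_definition rep_gen :: "'a::complex_algebra_1 \<Rightarrow> 'm::coalgebra \<Rightarrow> ('a, 'm) rep_alg" is rep_var .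

section \<open>The induced bracket and Poisson brackets\<close>

definition biderivation :: "('r::{comm_ring_1, complex_algebra_1} \<Rightarrow> 'r \<Rightarrow> 'r) \<Rightarrow> bool" where
  "biderivation B \<longleftrightarrow> cbilinear B \<and>
    (\<forall>x y z. B (x * y) z = x * B y z + B x z * y) \<and>
    (\<forall>x y z. B x (y * z) = y * B x z + B x y * z)"

text \<open>On generators the bracket of \<open>a\<^sub>\<alpha>\<close> and \<open>b\<^sub>\<beta>\<close> is
  \<open>\<nu>(\<alpha>, \<beta>\<^sup>2) D(a, b)'\<close> with index \<open>\<beta>\<^sup>1\<close> times \<open>D(a, b)''\<close> with index \<open>\<beta>\<^sup>3\<close>.\<close>

definition is_induced_bracket ::
  "(('a::complex_algebra_1, 'a) tensor \<Rightarrow> ('a, 'a) tensor) \<Rightarrow> ('m::coalgebra \<Rightarrow> 'm \<Rightarrow> complex)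
    \<Rightarrow> (('a, 'm) rep_alg \<Rightarrow> ('a, 'm) rep_alg \<Rightarrow> ('a, 'm) rep_alg) \<Rightarrow> bool" where
  "is_induced_bracket D \<nu> B \<longleftrightarrow> biderivation B \<and>
    (\<forall>a b \<alpha> \<beta>. B (rep_gen a \<alpha>) (rep_gen b \<beta>) =
      tensor3_lift (\<lambda>\<beta>1 \<beta>2 \<beta>3. \<nu> \<alpha> \<beta>2 *\<^sub>C
        tensor_lift (\<lambda>x y. rep_gen x \<beta>1 * rep_gen y \<beta>3) (D (a \<otimes> b))) (comult3 \<beta>))"

definition induced_bracket ::
  "(('a::complex_algebra_1, 'a) tensor \<Rightarrow> ('a, 'a) tensor) \<Rightarrow> ('m::coalgebra \<Rightarrow> 'm \<Rightarrow> complex)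
    \<Rightarrow> ('a, 'm) rep_alg \<Rightarrow> ('a, 'm) rep_alg \<Rightarrow> ('a, 'm) rep_alg" where
  "induced_bracket D \<nu> = (THE B. is_induced_bracket D \<nu> B)"

definition subalgebra :: "'r::complex_algebra_1 set \<Rightarrow> bool" where
  "subalgebra S \<longleftrightarrow> cvec.subspace S \<and> 1 \<in> S \<and> (\<forall>x\<in>S. \<forall>y\<in>S. x * y \<in> S)"

definition trace_algebra :: "'m::coalgebra \<Rightarrow> ('a::complex_algebra_1, 'm) rep_alg set" where
  "trace_algebra \<tau> = subalgebra hull {rep_gen a \<tau> | a. True}"

text \<open>\<open>B\<close> restricts to a Poisson bracket on the subalgebra \<open>S\<close>.\<close>

definition poisson_bracket_on ::
  "'r::{comm_ring_1, complex_algebra_1} set \<Rightarrow> ('r \<Rightarrow> 'r \<Rightarrow> 'r) \<Rightarrow> bool" where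
  "poisson_bracket_on S B \<longleftrightarrow> subalgebra S \<and>
    (\<forall>x\<in>S. \<forall>y\<in>S. B x y \<in> S) \<and>
    (\<forall>x\<in>S. \<forall>y\<in>S. \<forall>z\<in>S. B (x + y) z = B x z + B y z \<and> B x (y + z) = B x y + B x z) \<and>
    (\<forall>c. \<forall>x\<in>S. \<forall>y\<in>S. B (c *\<^sub>C x) y = c *\<^sub>C B x y \<and> B x (c *\<^sub>C y) = c *\<^sub>C B x y) \<and>
    (\<forall>x\<in>S. \<forall>y\<in>S. B x y = - B y x) \<and>
    (\<forall>x\<in>S. \<forall>y\<in>S. \<forall>z\<in>S. B x (B y z) + B y (B z x) + B z (B x y) = 0) \<and>
    (\<forall>x\<in>S. \<forall>y\<in>S. \<forall>z\<in>S. B x (y * z) = B x y * z + y * B x z)"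

end

theory Submission
  imports Defs
begin

text \<open>For a functional \<open>\<phi>\<close>, a tensor \<open>t' \<otimes> t''\<close> and \<open>\<beta>\<close> with triple coproduct \<open>\<beta>\<^sup>1 \<otimes> \<beta>\<^sup>2 \<otimes> \<beta>\<^sup>3\<close>, the
  contraction of the tensor at \<open>\<beta>\<close> along \<open>\<phi>\<close> is \<open>\<phi>(\<beta>\<^sup>2)\<close> times \<open>t'\<close> with index \<open>\<beta>\<^sup>1\<close> times \<open>t''\<close> with
  index \<open>\<beta>\<^sup>3\<close>.  The bracket of \<open>a\<^sub>\<alpha>\<close> and \<open>b\<^sub>\<beta>\<close> is the contraction of \<open>D(a, b)\<close> at \<open>\<beta>\<close> along
  \<open>\<nu>(\<alpha>, _)\<close>.

  The first task is to see that these values come from one and only one biderivation.  Uniqueness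
  holds because derivations are determined by the generators.  For existence the values must
  satisfy a Leibniz rule compatible with \<open>(ab)\<^sub>\<alpha> = a\<^sub>\<alpha>\<^sub>1 b\<^sub>\<alpha>\<^sub>2\<close> in each slot.  In the second slot this is
  coassociativity (\<open>contraction_mult_left\<close>, \<open>contraction_mult_right\<close>).  In the first slot it is
  the same computation: the balance condition on \<open>\<nu>\<close> says that \<open>\<alpha>\<close> and \<open>\<beta>\<close> may be
  interchanged if the two legs of \<open>D(a, b)\<close> are flipped (\<open>balanced_contraction\<close>), and the flip
  turns the outer Leibniz rule of \<open>D\<close> in its first argument into the inner one.  A function on
  generators with this Leibniz rule extends to a derivation of the representation algebra
  (\<open>rep_alg_derivation_extension\<close>); using this once for each slot gives the biderivation
  (\<open>biderivation_extension\<close>).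

  The trace element makes everything collapse.  As \<open>\<nu>(\<tau>, _)\<close> is the counit, the bracket of
  \<open>a\<^sub>\<tau>\<close> and \<open>b\<^sub>\<tau>\<close> is \<open>{a, b}\<^sub>\<tau>\<close>, where \<open>{a, b}\<close> is the product of the legs of \<open>D(a, b)\<close>
  (\<open>contraction_counit\<close>).  Balance at \<open>\<alpha> = \<beta> = \<tau>\<close> says that the coproduct of \<open>\<tau>\<close> is symmetric, so
  \<open>(ab)\<^sub>\<tau> = (ba)\<^sub>\<tau>\<close> and commutators vanish under \<open>x \<mapsto> x\<^sub>\<tau>\<close>.  Hence skew-symmetry of \<open>{_, _}\<close> modulo
  commutators becomes honest skew-symmetry on the elements \<open>a\<^sub>\<tau>\<close>, and the Leibniz form of the
  Jacobi identity for \<open>{_, _}\<close> becomes the Jacobi identity there.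

  Finally \<open>B x y + B y x\<close> and the Jacobiator are derivations in each argument, the latter on the
  generated subalgebra once skew-symmetry is known there.  So both identities pass from the
  elements \<open>a\<^sub>\<tau>\<close> to the subalgebra that they generate (\<open>poisson_bracket_on_hull\<close>).\<close>

section \<open>Multilinear calculus\<close>

text \<open>By definition \<open>tensor_lift f t\<close> is a finite linear combination of values of \<open>f\<close>.  This is why, in
  the lemmas below, linear maps move inside it and two such sums can be exchanged; bilinearity of the
  integrand enters only where the tensor itself is rewritten.\<close>

lemma tensor_lift_sum:
  "tensor_lift f t = (\<Sum>k\<in>Poly_Mapping.keys (rep_tensor t).
     Poly_Mapping.lookup (rep_tensor t) k *\<^sub>C f (fst k) (snd k))"
  by (simp add: tensor_lift_def free_extend_def case_prod_beta)

lemma tensor_lift_linear: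
  assumes "clinear h"
  shows "h (tensor_lift f t) = tensor_lift (\<lambda>x y. h (f x y)) t"
  by (simp add: tensor_lift_sum clinear_sum[OF assms] clinear_scaleC[OF assms])

lemma tensor_lift_swap:
  "tensor_lift (\<lambda>x y. tensor_lift (\<lambda>u v. g x y u v) t) s =
   tensor_lift (\<lambda>u v. tensor_lift (\<lambda>x y. g x y u v) s) t"
  unfolding tensor_lift_sum
  by (simp add: cvec.scale_sum_right, subst sum.swap)
    (simp add: scaleC_scaleC mult.commute)

lemma tensor_lift_add:
  "tensor_lift (\<lambda>x y. f x y + g x y) t = tensor_lift f t + tensor_lift g t"
  by (simp add: tensor_lift_sum scaleC_add_right sum.distrib)

text \<open>Most side conditions below state that an expression built from products, coproducts and tensor
  lifts is linear in one of its variables.  The collection \<open>clin\<close> decomposes such goals along the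
  syntax of the expression.\<close>

named_theorems clin

lemma clinear_id [clin]: "clinear (\<lambda>x::'a::complex_vector. x)"
  by (rule clinearI) auto

lemma clinear_compose:
  assumes "clinear h" "clinear f"
  shows "clinear (\<lambda>x. h (f x))"
  by (rule clinearI)
    (simp_all add: clinear_add[OF assms(1)] clinear_add[OF assms(2)]
      clinear_scaleC[OF assms(1)] clinear_scaleC[OF assms(2)])

lemma clinear_plus [clin]:
  "clinear f \<Longrightarrow> clinear g \<Longrightarrow> clinear (\<lambda>x. f x + g x)"
  by (rule clinearI) (simp_all add: clinear_add clinear_scaleC scaleC_add_right algebra_simps)

lemma clinear_minus [clin]:
  "clinear f \<Longrightarrow> clinear g \<Longrightarrow> clinear (\<lambda>x. f x - g x)"
  by (rule clinearI)
    (simp_all add: clinear_add clinear_scaleC cvec.scale_right_diff_distrib algebra_simps)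

lemma clinear_scale_const [clin]:
  "clinear f \<Longrightarrow> clinear (\<lambda>x. c *\<^sub>C f x)"
  by (rule clinearI) (simp_all add: clinear_add clinear_scaleC scaleC_add_right scaleC_scaleC mult.commute)

lemma clinear_scale_vector [clin]:
  "clinear f \<Longrightarrow> clinear (\<lambda>x. f x *\<^sub>C v)"
  by (rule clinearI)
    (simp_all add: clinear_add clinear_scaleC scaleC_add_left scaleC_scaleC scaleC_complex_def)

lemma clinear_mult_left [clin]:
  fixes f :: "'a::complex_vector \<Rightarrow> 'r::complex_algebra_1"
  shows "clinear f \<Longrightarrow> clinear (\<lambda>x. y * f x)"
  by (rule clinearI) (simp_all add: clinear_add clinear_scaleC distrib_left mult_scaleC_right)

lemma clinear_mult_right [clin]:
  fixes f :: "'a::complex_vector \<Rightarrow> 'r::complex_algebra_1"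
  shows "clinear f \<Longrightarrow> clinear (\<lambda>x. f x * y)"
  by (rule clinearI) (simp_all add: clinear_add clinear_scaleC distrib_right mult_scaleC_left)

lemma clinear_pure_left [clin]: "clinear f \<Longrightarrow> clinear (\<lambda>x. y \<otimes> f x)"
  by (rule clinearI) (simp_all add: clinear_add clinear_scaleC cbilinearD[OF cbilinear_tensor_pure])

lemma clinear_pure_right [clin]: "clinear f \<Longrightarrow> clinear (\<lambda>x. f x \<otimes> y)"
  by (rule clinearI) (simp_all add: clinear_add clinear_scaleC cbilinearD[OF cbilinear_tensor_pure])

lemma clinear_tensor_lift_integrand [clin]:
  assumes "\<And>u v. clinear (\<lambda>x. f x u v)"
  shows "clinear (\<lambda>x. tensor_lift (\<lambda>u v. f x u v) t)"
  by (rule clinearI)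
    (simp_all add: tensor_lift_sum clinear_add[OF assms] clinear_scaleC[OF assms] scaleC_add_right
      sum.distrib cvec.scale_sum_right scaleC_scaleC mult.commute)

lemma cbilinear_intro [clin]:
  assumes "\<And>x. clinear (\<lambda>y. f x y)" "\<And>y. clinear (\<lambda>x. f x y)"
  shows "cbilinear (\<lambda>x y. f x y)"
  using assms by (simp add: cbilinear_def)

lemma clinear_tensor_lift_argument [clin]:
  assumes "cbilinear (\<lambda>x y. f x y)" "clinear t"
  shows "clinear (\<lambda>z. tensor_lift (\<lambda>x y. f x y) (t z))"
  using clinear_compose[OF clinear_tensor_lift[OF assms(1)] assms(2)] .

lemma cbilinear_left: "cbilinear f \<Longrightarrow> clinear g \<Longrightarrow> clinear (\<lambda>x. f (g x) y)"
  by (rule clinear_compose[of "\<lambda>x. f x y"]) (simp_all add: cbilinear_def)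

lemma cbilinear_right: "cbilinear f \<Longrightarrow> clinear g \<Longrightarrow> clinear (\<lambda>y. f x (g y))"
  by (rule clinear_compose[of "\<lambda>y. f x y"]) (simp_all add: cbilinear_def)

text \<open>The relations of the representation algebra refer to presentations of a coproduct as a list of
  pure tensors; this and the next lemma translate between such lists and \<open>tensor_lift\<close>.\<close>

lemma tensor_pure_list:
  "\<exists>xs. t = (\<Sum>(x, y)\<leftarrow>xs. x \<otimes> y)"
proof (induction t rule: tensor_induct)
  case (pure x y)
  have "x \<otimes> y = (\<Sum>(x, y)\<leftarrow>[(x, y)]. x \<otimes> y)"
    by simp
  then show ?case ..
next
  case (add s t)
  then obtain xs ys where "s = (\<Sum>(x, y)\<leftarrow>xs. x \<otimes> y)" "t = (\<Sum>(x, y)\<leftarrow>ys. x \<otimes> y)"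
    by blast
  then have "s + t = (\<Sum>(x, y)\<leftarrow>xs @ ys. x \<otimes> y)"
    by simp
  then show ?case ..
qed

lemma tensor_lift_list:
  assumes "cbilinear f"
  shows "tensor_lift f (\<Sum>(x, y)\<leftarrow>xs. x \<otimes> y) = (\<Sum>(x, y)\<leftarrow>xs. f x y)"
  by (induction xs)
    (auto simp: clinear_zero[OF clinear_tensor_lift[OF assms]]
      clinear_add[OF clinear_tensor_lift[OF assms]] tensor_lift_pure[OF assms])

lemma tensor_lift_times_right:
  fixes f :: "'b::complex_vector \<Rightarrow> 'c::complex_vector \<Rightarrow> 'r::complex_algebra_1"
  shows "tensor_lift f t * y = tensor_lift (\<lambda>u v. f u v * y) t"
  by (rule tensor_lift_linear) (intro clin)

lemma tensor_lift_times_left: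
  fixes f :: "'b::complex_vector \<Rightarrow> 'c::complex_vector \<Rightarrow> 'r::complex_algebra_1"
  shows "y * tensor_lift f t = tensor_lift (\<lambda>u v. y * f u v) t"
  by (rule tensor_lift_linear) (intro clin)

lemma tensor_lift_scaleC: "c *\<^sub>C tensor_lift f t = tensor_lift (\<lambda>u v. c *\<^sub>C f u v) t"
  by (rule tensor_lift_linear) (intro clin)

lemma tensor_lift_pure_sum: "tensor_lift (\<otimes>) t = t"
  by (rule clinear_tensor_eqI[of "tensor_lift (\<otimes>)" "\<lambda>t. t"])
    (simp_all add: clinear_id clinear_tensor_lift tensor_lift_pure cbilinear_tensor_pure)

text \<open>Expanding \<open>t\<close> as a sum of pure tensors inside \<open>h\<close>.  Below, \<open>h\<close> is a multiplication by a pure tensor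
  or the flip, and \<open>h (x \<otimes> y)\<close> is again pure.\<close>

lemma tensor_lift_through:
  assumes "clinear h" "cbilinear f"
  shows "tensor_lift f (h t) = tensor_lift (\<lambda>x y. tensor_lift f (h (x \<otimes> y))) t"
proof -
  have "tensor_lift f (h t) = tensor_lift f (h (tensor_lift (\<otimes>) t))"
    by (simp add: tensor_lift_pure_sum)
  then show ?thesis
    by (simp only: tensor_lift_linear[OF assms(1)] tensor_lift_linear[OF clinear_tensor_lift[OF assms(2)]])
qed

lemma tensor_lift_mult_left:
  assumes f: "cbilinear f"
  shows "tensor_lift f ((b \<otimes> 1) * t) = tensor_lift (\<lambda>x y. f (b * x) y) t"
  by (subst tensor_lift_through[of "\<lambda>t. (b \<otimes> 1) * t" f, OF clinear_mult_left[OF clinear_id] f])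
    (simp add: times_tensor_pure tensor_lift_pure[OF f])

lemma tensor_lift_mult_right:
  assumes f: "cbilinear f"
  shows "tensor_lift f (t * (1 \<otimes> b)) = tensor_lift (\<lambda>x y. f x (y * b)) t"
  by (subst tensor_lift_through[of "\<lambda>t. t * (1 \<otimes> b)" f, OF clinear_mult_right[OF clinear_id] f])
    (simp add: times_tensor_pure tensor_lift_pure[OF f])

definition tensor_flip :: "('a::complex_vector, 'b::complex_vector) tensor \<Rightarrow> ('b, 'a) tensor" where
  "tensor_flip = tensor_lift (\<lambda>x y. y \<otimes> x)"

lemma tensor_flip_pure: "tensor_flip (x \<otimes> y) = y \<otimes> x"
  unfolding tensor_flip_def by (rule tensor_lift_pure) (intro clin)

lemma tensor_flip_linear: "clinear tensor_flip"
  unfolding tensor_flip_def by (rule clinear_tensor_lift) (intro clin)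

lemma tensor_lift_flip:
  assumes "cbilinear f"
  shows "tensor_lift f (tensor_flip t) = tensor_lift (\<lambda>x y. f y x) t"
  by (subst tensor_lift_through[OF tensor_flip_linear assms])
    (simp add: tensor_flip_pure tensor_lift_pure[OF assms])

lemma tensor_flip_mult:
  "tensor_flip (s * t) = tensor_flip s * tensor_flip t"
proof (induction s rule: tensor_induct)
  case (pure a b)
  show ?case
    by (induction t rule: tensor_induct)
      (simp_all add: times_tensor_pure tensor_flip_pure clinear_add[OF tensor_flip_linear] distrib_left)
qed (simp add: clinear_add[OF tensor_flip_linear] distrib_right)

section \<open>Sweedler sums\<close>

text \<open>Sweedler notation: \<open>sweedler f \<alpha>\<close> stands for the sum \<open>f(\<alpha>\<^sup>1, \<alpha>\<^sup>2)\<close> over the legs of the coproduct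
  of \<open>\<alpha>\<close>.\<close>

abbreviation sweedler ::
  "('m::coalgebra \<Rightarrow> 'm \<Rightarrow> 'c::complex_vector) \<Rightarrow> 'm \<Rightarrow> 'c" where
  "sweedler f \<alpha> \<equiv> tensor_lift f (comult \<alpha>)"

lemmas comult_linear_compose [clin] = clinear_compose[OF clinear_comult]

text \<open>Coassociativity is an identity between triple tensors; evaluating a trilinear map on both sides
  gives the form in which it is used for nested sums.\<close>

lemma sweedler_coassoc:
  fixes g :: "'m::coalgebra \<Rightarrow> 'm \<Rightarrow> 'm \<Rightarrow> 'c::complex_vector"
  assumes [clin]: "\<And>y z. clinear (\<lambda>x. g x y z)" "\<And>x z. clinear (\<lambda>y. g x y z)"
    "\<And>x y. clinear (\<lambda>z. g x y z)"
  shows "sweedler (\<lambda>x z. sweedler (\<lambda>u v. g u v z) x) \<alpha> =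
    sweedler (\<lambda>x y. sweedler (\<lambda>u v. g x u v) y) \<alpha>"
proof -
  have bil: "cbilinear (\<lambda>x. tensor_lift (g x))"
    by (intro clin)
  have lin: "clinear (tensor3_lift g)"
    unfolding tensor3_lift_def by (rule clinear_tensor_lift[OF bil])
  have pure: "tensor3_lift g (x \<otimes> t) = tensor_lift (g x) t" for x t
    unfolding tensor3_lift_def by (rule tensor_lift_pure[OF bil])
  have gbil: "cbilinear (g x)" for x
    by (intro clin)
  have abil: "cbilinear (\<lambda>t (z::'m). tensor_lift (\<lambda>(x::'m) (y::'m). x \<otimes> (y \<otimes> z)) t)"
    by (intro clin)
  have alin: "clinear (tensor_assoc :: (('m, 'm) tensor, 'm) tensor \<Rightarrow> _)"
    unfolding tensor_assoc_def by (rule clinear_tensor_lift[OF abil])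
  have apure: "tensor_assoc (t \<otimes> z) = tensor_lift (\<lambda>x y. x \<otimes> (y \<otimes> z)) t"
    for t :: "('m, 'm) tensor" and z :: 'm
    unfolding tensor_assoc_def by (rule tensor_lift_pure[OF abil])
  have "tensor3_lift g (tensor_assoc (tensor_map comult id (comult \<alpha>))) =
      tensor3_lift g (tensor_map id comult (comult \<alpha>))"
    by (simp only: coassoc)
  then show ?thesis
    unfolding tensor_map_def
    by (simp add: tensor_lift_linear[OF lin] tensor_lift_linear[OF alin] apure pure tensor_lift_pure[OF gbil])
qed

lemma comult3_lift:
  fixes g :: "'m::coalgebra \<Rightarrow> 'm \<Rightarrow> 'm \<Rightarrow> 'c::complex_vector"
  assumes [clin]: "\<And>y z. clinear (\<lambda>x. g x y z)" "\<And>x z. clinear (\<lambda>y. g x y z)"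
    "\<And>x y. clinear (\<lambda>z. g x y z)"
  shows "tensor3_lift g (comult3 \<alpha>) = sweedler (\<lambda>x y. sweedler (g x) y) \<alpha>"
proof -
  have bil: "cbilinear (\<lambda>x. tensor_lift (g x))"
    by (intro clin)
  show ?thesis
    unfolding tensor3_lift_def comult3_def tensor_map_def
    by (simp add: tensor_lift_linear[OF clinear_tensor_lift[OF bil]] tensor_lift_pure[OF bil])
qed

section \<open>Derivations and generated subalgebras\<close>

definition derivation :: "('r::complex_algebra_1 \<Rightarrow> 'r) \<Rightarrow> bool" where
  "derivation d \<longleftrightarrow> clinear d \<and> (\<forall>x y. d (x * y) = x * d y + d x * y)"

lemma derivation_linear: "derivation d \<Longrightarrow> clinear d"
  by (simp add: derivation_def)

lemma derivation_mult: "derivation d \<Longrightarrow> d (x * y) = x * d y + d x * y"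
  by (simp add: derivation_def)

lemma derivationI:
  assumes "clinear d" "\<And>x y. d (x * y) = x * d y + d x * y"
  shows "derivation d"
  using assms by (simp add: derivation_def)

lemma derivation_one:
  assumes "derivation d" shows "d 1 = 0"
  using derivation_mult[OF assms, of 1 1] by simp

lemma derivation_diff:
  assumes "derivation d" "derivation e"
  shows "derivation (\<lambda>x. d x - e x)"
proof (rule derivationI)
  show "clinear (\<lambda>x. d x - e x)"
    by (intro clin derivation_linear assms)
qed (simp add: derivation_mult[OF assms(1)] derivation_mult[OF assms(2)] algebra_simps)

lemma derivation_add:
  assumes "derivation d" "derivation e"
  shows "derivation (\<lambda>x. d x + e x)"
proof (rule derivationI)
  show "clinear (\<lambda>x. d x + e x)"
    by (intro clin derivation_linear assms)
qed (simp add: derivation_mult[OF assms(1)] derivation_mult[OF assms(2)] algebra_simps)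

lemma derivation_mult_const:
  fixes d :: "'r::{comm_ring_1, complex_algebra_1} \<Rightarrow> 'r"
  assumes "derivation d"
  shows "derivation (\<lambda>x. c * d x)" "derivation (\<lambda>x. d x * c)"
proof -
  show 1: "derivation (\<lambda>x. c * d x)"
    by (rule derivationI)
      (intro clin derivation_linear[OF assms], simp add: derivation_mult[OF assms] algebra_simps)
  then show "derivation (\<lambda>x. d x * c)"
    by (simp add: mult.commute)
qed

lemma derivation_scaleC:
  assumes "derivation d"
  shows "derivation (\<lambda>x. c *\<^sub>C d x)"
  by (rule derivationI)
    (intro clin derivation_linear[OF assms], simp add: derivation_mult[OF assms] scaleC_add_right
      mult_scaleC_left mult_scaleC_right)

lemma derivation_zero: "derivation (\<lambda>x. 0)"
  by (rule derivationI) (auto intro!: clinearI)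

lemma derivation_sum:
  assumes "\<And>i. i \<in> A \<Longrightarrow> derivation (d i)"
  shows "derivation (\<lambda>x. \<Sum>i\<in>A. d i x)"
  using assms
  by (induction A rule: infinite_finite_induct) (auto simp: derivation_zero intro!: derivation_add)

lemma derivation_tensor_lift:
  assumes "\<And>u v. derivation (\<lambda>x. f x u v)"
  shows "derivation (\<lambda>x. tensor_lift (\<lambda>u v. f x u v) t)"
  unfolding tensor_lift_sum by (intro derivation_sum derivation_scaleC assms)

text \<open>The mixed terms \<open>d x * e y\<close> and \<open>e x * d y\<close> are symmetric in \<open>d\<close> and \<open>e\<close> and cancel.\<close>

lemma derivation_commutator:
  assumes "derivation d" "derivation e"
  shows "derivation (\<lambda>x. d (e x) - e (d x))"
proof (rule derivationI)
  show "clinear (\<lambda>x. d (e x) - e (d x))"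
    by (intro clin clinear_compose[of d e] clinear_compose[of e d] derivation_linear assms)
qed (simp add: derivation_mult[OF assms(1)] derivation_mult[OF assms(2)]
    clinear_add[OF derivation_linear[OF assms(1)]] clinear_add[OF derivation_linear[OF assms(2)]] algebra_simps)

lemma subalgebraI:
  assumes "\<And>x y. x \<in> S \<Longrightarrow> y \<in> S \<Longrightarrow> x + y \<in> S" "\<And>c x. x \<in> S \<Longrightarrow> c *\<^sub>C x \<in> S"
    and "1 \<in> S" "\<And>x y. x \<in> S \<Longrightarrow> y \<in> S \<Longrightarrow> x * y \<in> S"
  shows "subalgebra S"
  unfolding subalgebra_def
  using assms assms(2)[OF assms(3), of 0] by (auto intro!: cvec.subspaceI)

lemma subalgebraD:
  assumes "subalgebra S"
  shows "x \<in> S \<Longrightarrow> y \<in> S \<Longrightarrow> x + y \<in> S" "x \<in> S \<Longrightarrow> c *\<^sub>C x \<in> S"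
    and "1 \<in> S" "x \<in> S \<Longrightarrow> y \<in> S \<Longrightarrow> x * y \<in> S" "0 \<in> S"
  using assms by (auto simp: subalgebra_def cvec.subspace_add cvec.subspace_scale cvec.subspace_0)

lemma subalgebra_hull: "subalgebra (subalgebra hull G)"
proof (rule hull_in)
  fix T :: "'a set set"
  assume "Ball T subalgebra"
  then show "subalgebra (\<Inter>T)"
    by (auto simp: subalgebra_def intro!: cvec.subspace_Inter)
qed

text \<open>The elements of the hull that \<open>d\<close> maps into the hull form a subalgebra.  Membership in the
  hull has to be carried along because the Leibniz rule also involves the factors themselves.\<close>

lemma derivation_preserves_hull:
  assumes d: "derivation d" and G: "\<And>g. g \<in> G \<Longrightarrow> d g \<in> subalgebra hull G"
    and x: "x \<in> subalgebra hull G"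
  shows "d x \<in> subalgebra hull G"
proof -
  let ?S = "subalgebra hull G"
  note S = subalgebraD[OF subalgebra_hull[of G]]
  note lin = derivation_linear[OF d]
  have "x \<in> ?S \<and> d x \<in> ?S"
  proof (rule hull_induct[OF x])
    show "subalgebra {x. x \<in> ?S \<and> d x \<in> ?S}"
      by (rule subalgebraI)
        (auto simp: S clinear_add[OF lin] clinear_scaleC[OF lin] derivation_one[OF d] derivation_mult[OF d])
  qed (auto simp: G hull_inc)
  then show ?thesis ..
qed

text \<open>The kernel of a derivation is a subalgebra, so a derivation is determined by its values on
  generators.\<close>

lemma derivation_hull_zero:
  assumes d: "derivation d" and G: "\<And>g. g \<in> G \<Longrightarrow> d g = 0"
    and x: "x \<in> subalgebra hull G"
  shows "d x = 0"
proof (rule hull_induct[OF x])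
  note lin = derivation_linear[OF d]
  show "subalgebra {x. d x = 0}"
    by (rule subalgebraI)
      (simp_all add: clinear_add[OF lin] clinear_scaleC[OF lin] derivation_one[OF d] derivation_mult[OF d])
qed (rule G)

lemma biderivationD:
  assumes "biderivation B"
  shows "derivation (B x)" "derivation (\<lambda>x. B x y)"
  using assms by (auto simp: biderivation_def derivation_def cbilinear_def)

lemma biderivationI:
  assumes "\<And>x. derivation (B x)" "\<And>y. derivation (\<lambda>x. B x y)"
  shows "biderivation B"
  using assms by (auto simp: biderivation_def derivation_def cbilinear_def)

text \<open>Each axiom is extended from the generators one argument at a time, the defect being a derivation
  in that argument.  For the Jacobi identity this is visible in the Leibniz form
  \<open>B x (B y z) - B y (B x z) - B (B x y) z\<close> for the argument \<open>z\<close>: it is the commutator of the derivations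
  \<open>B x\<close> and \<open>B y\<close> minus the derivation \<open>B (B x y)\<close>.  The cyclic symmetry of the Jacobiator moves every argument into this position.\<close>

lemma poisson_bracket_on_hull:
  fixes B :: "'r::{comm_ring_1, complex_algebra_1} \<Rightarrow> 'r \<Rightarrow> 'r"
  assumes B: "biderivation B"
    and closed: "\<And>x y. x \<in> G \<Longrightarrow> y \<in> G \<Longrightarrow> B x y \<in> subalgebra hull G"
    and skew: "\<And>x y. x \<in> G \<Longrightarrow> y \<in> G \<Longrightarrow> B x y = - B y x"
    and jacobi: "\<And>x y z. x \<in> G \<Longrightarrow> y \<in> G \<Longrightarrow> z \<in> G \<Longrightarrow>
      B x (B y z) + B y (B z x) + B z (B x y) = 0"
  shows "poisson_bracket_on (subalgebra hull G) B"
proof -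
  let ?S = "subalgebra hull G"
  note d1 = biderivationD(1)[OF B] and d2 = biderivationD(2)[OF B]
  note bil = cbilinearD[OF B[unfolded biderivation_def, THEN conjunct1]]
  have neg: "B x (- y) = - B x y" for x y
    by (rule clinear_uminus[OF derivation_linear[OF d1]])
  have inG: "x \<in> ?S" if "x \<in> G" for x
    using that by (rule hull_inc)
  have closed1: "B x y \<in> ?S" if "x \<in> ?S" "y \<in> G" for x y
    by (rule derivation_preserves_hull[OF d2 _ that(1)]) (rule closed[OF _ that(2)])
  have closed2: "B x y \<in> ?S" if "x \<in> ?S" "y \<in> ?S" for x y
    by (rule derivation_preserves_hull[OF d1 _ that(2)]) (rule closed1[OF that(1)])
  have skew1: "B x y + B y x = 0" if "x \<in> ?S" "y \<in> G" for x y
    by (rule derivation_hull_zero[OF derivation_add[OF d2 d1] _ that(1)]) (simp add: skew[OF _ that(2)])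
  have skew2: "B x y + B y x = 0" if "x \<in> ?S" "y \<in> ?S" for x y
    by (rule derivation_hull_zero[OF derivation_add[OF d1 d2] _ that(2)]) (rule skew1[OF that(1)])
  have skewS: "B x y = - B y x" if "x \<in> ?S" "y \<in> ?S" for x y
    using skew2[OF that] by (simp add: eq_neg_iff_add_eq_0)
  define J where "J x y z = B x (B y z) + B y (B z x) + B z (B x y)" for x y z
  have cyc: "J x y z = J y z x" for x y z
    by (simp add: J_def algebra_simps)
  have der: "derivation (\<lambda>z. (B x (B y z) - B y (B x z)) - B (B x y) z)" for x y
    by (intro derivation_diff[OF derivation_commutator] d1)
  have J_eq: "J x y z = (B x (B y z) - B y (B x z)) - B (B x y) z"
    if "x \<in> ?S" "y \<in> ?S" "z \<in> ?S" for x y z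
    using skewS[OF that(3,1)] skewS[OF that(3) closed2[OF that(1,2)]] by (simp add: J_def neg)
  have extend: "J x y z = 0"
    if "x \<in> ?S" "y \<in> ?S" "z \<in> ?S" "\<And>g. g \<in> G \<Longrightarrow> J x y g = 0" for x y z
    unfolding J_eq[OF that(1-3)]
    by (rule derivation_hull_zero[OF der _ that(3)]) (use that(4) J_eq[OF that(1,2)] inG in simp)
  have J1: "J x y z = 0" if "x \<in> G" "y \<in> G" "z \<in> ?S" for x y z
    by (rule extend) (use that inG jacobi in \<open>auto simp: J_def\<close>)
  have J2: "J x y z = 0" if "x \<in> G" "y \<in> ?S" "z \<in> ?S" for x y z
    by (rule extend) (use that inG J1[of _ x y] cyc[of _ x y] in auto)
  have J3: "J x y z = 0" if "x \<in> ?S" "y \<in> ?S" "z \<in> ?S" for x y z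
    by (rule extend) (use that inG J2[of _ x y] cyc[of _ x y] in auto)
  show ?thesis
    unfolding poisson_bracket_on_def
  proof (intro conjI allI ballI)
    fix x y z
    assume "x \<in> ?S" "y \<in> ?S" "z \<in> ?S"
    then show "B x (B y z) + B y (B z x) + B z (B x y) = 0"
      using J3 by (simp add: J_def)
    show "B x (y * z) = B x y * z + y * B x z"
      by (simp add: derivation_mult[OF d1])
  next
    fix x y
    assume "x \<in> ?S" "y \<in> ?S"
    then show "B x y = - B y x"
      by (rule skewS)
  qed (simp_all add: subalgebra_hull closed2 bil)
qed

section \<open>Derivations of the representation algebra\<close>

text \<open>The value at the monomial \<open>m\<close> of the derivation along a multiplicative map \<open>\<pi>\<close> that sends the
  variable \<open>k\<close> to \<open>f k\<close>: the sum over \<open>k\<close> of \<open>f k\<close> times the image of the partial derivative of \<open>m\<close>.\<close>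

definition monomial_derivation ::
  "('k \<Rightarrow> 'r) \<Rightarrow> (('k \<Rightarrow>\<^sub>0 nat) \<Rightarrow> 'r) \<Rightarrow> ('k \<Rightarrow>\<^sub>0 nat) \<Rightarrow> 'r::comm_ring_1" where
  "monomial_derivation f \<pi> m =
    (\<Sum>k\<in>Poly_Mapping.keys m. of_nat (Poly_Mapping.lookup m k) * f k * \<pi> (m - Poly_Mapping.single k 1))"

lemma monomial_derivation_superset:
  assumes "finite A" "Poly_Mapping.keys m \<subseteq> A"
  shows "monomial_derivation f \<pi> m =
    (\<Sum>k\<in>A. of_nat (Poly_Mapping.lookup m k) * f k * \<pi> (m - Poly_Mapping.single k 1))"
  unfolding monomial_derivation_def
  by (rule sum.mono_neutral_left) (use assms in \<open>auto simp: in_keys_iff\<close>)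

text \<open>Monomials are written additively through their exponents, so this is the Leibniz rule.\<close>

lemma monomial_derivation_add:
  assumes \<pi>: "\<And>m n. \<pi> (m + n) = \<pi> m * \<pi> n"
  shows "monomial_derivation f \<pi> (m + n) = \<pi> m * monomial_derivation f \<pi> n + monomial_derivation f \<pi> m * \<pi> n"
proof -
  let ?A = "Poly_Mapping.keys m \<union> Poly_Mapping.keys n"
  \<comment> \<open>Truncated subtraction of exponents is harmless: it only truncates where the coefficient is zero.\<close>
  have drop: "of_nat (Poly_Mapping.lookup p k) * \<pi> (p + q - Poly_Mapping.single k 1) =
      of_nat (Poly_Mapping.lookup p k) * (\<pi> (p - Poly_Mapping.single k 1) * \<pi> q)" for p q k
  proof (cases "Poly_Mapping.lookup p k = 0")
    case False
    then have "p + q - Poly_Mapping.single k 1 = (p - Poly_Mapping.single k 1) + q"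
      by (intro poly_mapping_eqI) (auto simp: lookup_add lookup_minus lookup_single when_def)
    then show ?thesis
      by (simp add: \<pi>)
  qed simp
  have "of_nat (Poly_Mapping.lookup (m + n) k) * f k * \<pi> (m + n - Poly_Mapping.single k 1) =
      \<pi> m * (of_nat (Poly_Mapping.lookup n k) * f k * \<pi> (n - Poly_Mapping.single k 1)) +
      of_nat (Poly_Mapping.lookup m k) * f k * \<pi> (m - Poly_Mapping.single k 1) * \<pi> n" for k
    using drop[of m k n] drop[of n k m]
    by (simp add: lookup_add distrib_right distrib_left ac_simps)
  then show ?thesis
    using Poly_Mapping.keys_add[of m n]
    by (simp add: monomial_derivation_superset[of ?A] sum.distrib sum_distrib_left sum_distrib_right)
qed

lemma clinear_poly_mapping_eqI:
  fixes f g :: "('k \<Rightarrow>\<^sub>0 complex) \<Rightarrow> 'b::complex_vector"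
  assumes "clinear f" "clinear g" "\<And>k. f (Poly_Mapping.single k 1) = g (Poly_Mapping.single k 1)"
  shows "f p = g p"
proof -
  have expand: "h p = (\<Sum>k\<in>Poly_Mapping.keys p. Poly_Mapping.lookup p k *\<^sub>C h (Poly_Mapping.single k 1))"
    if "clinear h" for h :: "('k \<Rightarrow>\<^sub>0 complex) \<Rightarrow> 'b"
    using arg_cong[OF free_extend_expand[of p], of h]
    by (simp add: clinear_sum[OF that] clinear_scaleC[OF that])
  show ?thesis
    by (simp only: expand[OF assms(1)] expand[OF assms(2)] assms(3))
qed

lemma abs_rep_alg_linear: "clinear (abs_rep_alg :: ('a::complex_algebra_1, 'm::coalgebra) rep_poly \<Rightarrow> _)"
  by (rule clinearI) (simp_all add: plus_rep_alg.abs_eq scaleC_rep_alg.abs_eq)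

lemma abs_rep_alg_mult: "abs_rep_alg (p * q) = abs_rep_alg p * abs_rep_alg q"
  by (simp add: times_rep_alg.abs_eq)

lemma abs_rep_alg_one: "abs_rep_alg 1 = 1"
  by (simp add: one_rep_alg.abs_eq)

lemma abs_rep_alg_zero_iff: "abs_rep_alg p = 0 \<longleftrightarrow> p \<in> generated_ideal rep_relators"
  by (simp add: zero_rep_alg_def rep_alg.abs_eq_iff)

lemma rep_alg_exhaust: obtains p where "x = abs_rep_alg p"
  by (metis Quotient3_abs_rep[OF Quotient3_rep_alg])

lemma rep_gen_eq: "rep_gen a \<alpha> = abs_rep_alg (rep_var a \<alpha>)"
  by (rule rep_gen.abs_eq)

lemma relator_eq_zero: "r \<in> rep_relators \<Longrightarrow> abs_rep_alg r = 0"
  unfolding abs_rep_alg_zero_iff by (rule module.span_base[OF module_cring])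

lemma rep_gen_cbilinear:
  "cbilinear (rep_gen :: 'a::complex_algebra_1 \<Rightarrow> 'm::coalgebra \<Rightarrow> _)"
proof (rule cbilinearI)
  note lin = clinear_diff[OF abs_rep_alg_linear] clinear_add[OF abs_rep_alg_linear] clinear_scaleC[OF abs_rep_alg_linear]
  note r = rep_relators.intros(1-4)[THEN relator_eq_zero]
  fix a b :: 'a and \<alpha> \<beta> :: 'm and c
  show "rep_gen (a + b) \<alpha> = rep_gen a \<alpha> + rep_gen b \<alpha>"
    using r(1)[of a b \<alpha>] by (simp add: rep_gen_eq lin algebra_simps)
  show "rep_gen a (\<alpha> + \<beta>) = rep_gen a \<alpha> + rep_gen a \<beta>"
    using r(3)[of a \<alpha> \<beta>] by (simp add: rep_gen_eq lin algebra_simps)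
  show "rep_gen (c *\<^sub>C a) \<alpha> = c *\<^sub>C rep_gen a \<alpha>"
    using r(2)[of c a \<alpha>] by (simp add: rep_gen_eq lin)
  show "rep_gen a (c *\<^sub>C \<alpha>) = c *\<^sub>C rep_gen a \<alpha>"
    using r(4)[of a c \<alpha>] by (simp add: rep_gen_eq lin)
qed

lemmas rep_gen_linear_left [clin] = cbilinear_left[OF rep_gen_cbilinear]
lemmas rep_gen_linear_right [clin] = cbilinear_right[OF rep_gen_cbilinear]

lemma abs_rep_alg_sum_list:
  "abs_rep_alg (\<Sum>(x, y)\<leftarrow>xs. f x y) = (\<Sum>(x, y)\<leftarrow>xs. abs_rep_alg (f x y))"
  by (induction xs)
    (auto simp: clinear_zero[OF abs_rep_alg_linear] clinear_add[OF abs_rep_alg_linear])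

lemma rep_gen_mult:
  "rep_gen (a * b) \<alpha> = sweedler (\<lambda>\<alpha>1 \<alpha>2. rep_gen a \<alpha>1 * rep_gen b \<alpha>2) \<alpha>"
proof -
  obtain xs where xs: "comult \<alpha> = (\<Sum>(\<alpha>1, \<alpha>2)\<leftarrow>xs. \<alpha>1 \<otimes> \<alpha>2)"
    using tensor_pure_list by blast
  have bil: "cbilinear (\<lambda>\<alpha>1 \<alpha>2. rep_gen a \<alpha>1 * rep_gen b \<alpha>2)"
    by (intro clin)
  have "rep_gen (a * b) \<alpha> = (\<Sum>(\<alpha>1, \<alpha>2)\<leftarrow>xs. rep_gen a \<alpha>1 * rep_gen b \<alpha>2)"
    using relator_eq_zero[OF rep_relators.intros(5)[OF xs, of a b]]
    by (simp add: clinear_diff[OF abs_rep_alg_linear] abs_rep_alg_sum_list abs_rep_alg_mult rep_gen_eq)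
  then show ?thesis
    by (simp add: xs tensor_lift_list[OF bil])
qed

text \<open>Monomials are products of powers of variables, and every variable maps to some \<open>a\<^sub>\<alpha>\<close>.\<close>

lemma rep_alg_generated:
  "x \<in> subalgebra hull range (\<lambda>(a, \<alpha>). rep_gen a \<alpha>)"
proof -
  let ?S = "subalgebra hull range (\<lambda>(a, \<alpha>). rep_gen a \<alpha>) :: ('a, 'b) rep_alg set"
  let ?\<pi> = "\<lambda>m. abs_rep_alg (Poly_Mapping.single m 1) :: ('a, 'b) rep_alg"
  note S = subalgebraD[OF subalgebra_hull[of "range (\<lambda>(a, \<alpha>). rep_gen a \<alpha>) :: ('a, 'b) rep_alg set"]]
  have \<pi>: "?\<pi> (m + n) = ?\<pi> m * ?\<pi> n" for m n
    by (simp add: mult_single flip: abs_rep_alg_mult)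
  have power: "?\<pi> (Poly_Mapping.single k n) \<in> ?S" for k n
  proof (induction n)
    case (Suc n)
    obtain a \<alpha> where k: "k = (a, \<alpha>)"
      by (cases k)
    have "?\<pi> (Poly_Mapping.single k (Suc n)) = ?\<pi> (Poly_Mapping.single k 1) * ?\<pi> (Poly_Mapping.single k n)"
      by (simp add: \<pi>[symmetric] flip: single_add)
    moreover have "?\<pi> (Poly_Mapping.single k 1) \<in> ?S"
      by (rule hull_inc) (auto simp: k rep_gen_eq rep_var_def)
    ultimately show ?case
      using Suc S(4) by simp
  qed (simp add: abs_rep_alg_one S(3))
  have sums: "?\<pi> (\<Sum>k\<in>A. Poly_Mapping.single k (n k)) \<in> ?S" if "finite A" for A n
    using that by induction (simp_all add: \<pi> abs_rep_alg_one S power)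
  have mono: "?\<pi> m \<in> ?S" for m
  proof -
    have "m = (\<Sum>k\<in>Poly_Mapping.keys m. Poly_Mapping.single k (Poly_Mapping.lookup m k))"
      by (rule poly_mapping_eqI) (simp add: lookup_sum lookup_single when_def in_keys_iff)
    then show ?thesis
      using sums[OF finite_keys] by metis
  qed
  have span: "(\<Sum>m\<in>A. c m *\<^sub>C ?\<pi> m) \<in> ?S" if "finite A" for A c
    using that by induction (simp_all add: S mono)
  obtain p where x: "x = abs_rep_alg p"
    by (rule rep_alg_exhaust)
  have "x = (\<Sum>m\<in>Poly_Mapping.keys p. Poly_Mapping.lookup p m *\<^sub>C ?\<pi> m)"
    unfolding x by (subst free_extend_expand)
      (simp add: clinear_sum[OF abs_rep_alg_linear] clinear_scaleC[OF abs_rep_alg_linear])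
  then show ?thesis
    using span by simp
qed

lemma derivation_eq_on_generators:
  fixes d e :: "('a::complex_algebra_1, 'm::coalgebra) rep_alg \<Rightarrow> ('a, 'm) rep_alg"
  assumes "derivation d" "derivation e" "\<And>a \<alpha>. d (rep_gen a \<alpha>) = e (rep_gen a \<alpha>)"
  shows "d x = e x"
proof -
  have "d x - e x = 0"
    by (rule derivation_hull_zero[OF derivation_diff[OF assms(1,2)] _ rep_alg_generated])
      (auto simp: assms(3))
  then show ?thesis
    by simp
qed

lemma clinear_rep_poly_mult:
  "clinear (\<lambda>p. p * (q :: ('a, 'm) rep_poly))" "clinear (\<lambda>p. (q :: ('a, 'm) rep_poly) * p)"
  by (rule clinearI; simp add: scaleC_rep_poly algebra_simps)+

text \<open>On the polynomial ring a derivation along the quotient map may take arbitrary values on the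
  variables.\<close>

lemma rep_poly_derivation:
  fixes f :: "'a::complex_algebra_1 \<Rightarrow> 'm::coalgebra \<Rightarrow> ('a, 'm) rep_alg"
  obtains d :: "('a, 'm) rep_poly \<Rightarrow> ('a, 'm) rep_alg"
  where "clinear d" "\<And>p q. d (p * q) = abs_rep_alg p * d q + d p * abs_rep_alg q"
    "\<And>a \<alpha>. d (rep_var a \<alpha>) = f a \<alpha>"
proof
  let ?\<pi> = "\<lambda>m. abs_rep_alg (Poly_Mapping.single m 1) :: ('a, 'm) rep_alg"
  let ?D = "monomial_derivation (\<lambda>(a, \<alpha>). f a \<alpha>) ?\<pi>"
  let ?d = "free_extend ?D"
  show lin: "clinear ?d"
    by (rule free_extend_linear)
  have \<pi>: "?\<pi> (m + n) = ?\<pi> m * ?\<pi> n" for m n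
    by (simp add: mult_single flip: abs_rep_alg_mult)
  note lins = clinear_compose[OF lin] clinear_rep_poly_mult lin abs_rep_alg_linear
  have monomial: "?d (p * Poly_Mapping.single n 1) = abs_rep_alg p * ?D n + ?d p * ?\<pi> n" for p n
  proof (rule clinear_poly_mapping_eqI[of "\<lambda>p. ?d (p * Poly_Mapping.single n 1)"
        "\<lambda>p. abs_rep_alg p * ?D n + ?d p * ?\<pi> n"])
    show "clinear (\<lambda>p. ?d (p * Poly_Mapping.single n 1))"
      "clinear (\<lambda>p. abs_rep_alg p * ?D n + ?d p * ?\<pi> n)"
      by (intro clin lins)+
  qed (simp add: mult_single free_extend_single monomial_derivation_add[OF \<pi>])
  show "?d (p * q) = abs_rep_alg p * ?d q + ?d p * abs_rep_alg q" for p q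
  proof (rule clinear_poly_mapping_eqI[of "\<lambda>q. ?d (p * q)"
        "\<lambda>q. abs_rep_alg p * ?d q + ?d p * abs_rep_alg q"])
    show "clinear (\<lambda>q. ?d (p * q))" "clinear (\<lambda>q. abs_rep_alg p * ?d q + ?d p * abs_rep_alg q)"
      by (intro clin lins)+
  qed (simp add: monomial free_extend_single)
  show "?d (rep_var a \<alpha>) = f a \<alpha>" for a \<alpha>
    by (simp add: rep_var_def free_extend_single monomial_derivation_def abs_rep_alg_one)
qed

text \<open>The derivation of the polynomial ring with the prescribed values vanishes on the relators: on the
  linear ones because \<open>f\<close> is bilinear, on the multiplicative ones by the Leibniz rule assumed for \<open>f\<close>.
  By its own Leibniz rule it then vanishes on the ideal that they generate, and it descends to the
  quotient.\<close>

lemma rep_alg_derivation_extension: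
  fixes f :: "'a::complex_algebra_1 \<Rightarrow> 'm::coalgebra \<Rightarrow> ('a, 'm) rep_alg"
  assumes f: "cbilinear f"
    and mult: "\<And>a b \<alpha>. f (a * b) \<alpha> =
      sweedler (\<lambda>\<alpha>1 \<alpha>2. rep_gen a \<alpha>1 * f b \<alpha>2 + f a \<alpha>1 * rep_gen b \<alpha>2) \<alpha>"
  shows "\<exists>d. derivation d \<and> (\<forall>a \<alpha>. d (rep_gen a \<alpha>) = f a \<alpha>)"
proof -
  obtain \<delta> where lin: "clinear \<delta>"
    and leibniz: "\<And>p q. \<delta> (p * q) = abs_rep_alg p * \<delta> q + \<delta> p * abs_rep_alg q"
    and var: "\<And>a \<alpha>. \<delta> (rep_var a \<alpha>) = f a \<alpha>"
    using rep_poly_derivation[of f] by blast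
  note lins = clinear_diff[OF lin] clinear_add[OF lin] clinear_scaleC[OF lin]
  have relator: "\<delta> r = 0" if "r \<in> rep_relators" for r
    using that
  proof cases
    case (5 \<alpha> xs a b)
    have bil: "cbilinear (\<lambda>\<alpha>1 \<alpha>2. rep_gen a \<alpha>1 * f b \<alpha>2 + f a \<alpha>1 * rep_gen b \<alpha>2)"
      by (intro clin cbilinear_right[OF f])
    have "\<delta> (\<Sum>(\<alpha>1, \<alpha>2)\<leftarrow>ys. rep_var a \<alpha>1 * rep_var b \<alpha>2) =
        (\<Sum>(\<alpha>1, \<alpha>2)\<leftarrow>ys. rep_gen a \<alpha>1 * f b \<alpha>2 + f a \<alpha>1 * rep_gen b \<alpha>2)" for ys
      by (induction ys) (auto simp: clinear_zero[OF lin] lins leibniz var rep_gen_eq)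
    then show ?thesis
      by (simp add: 5(1) lins var mult 5(2) tensor_lift_list[OF bil])
  qed (simp_all add: lins var cbilinearD[OF f])
  have ideal: "\<delta> p = 0" if "p \<in> generated_ideal rep_relators" for p
    using that
    by (induction rule: ideal_induct)
      (simp_all add: clinear_zero[OF lin] lins leibniz relator relator_eq_zero)
  define d where "d x = \<delta> (rep_rep_alg x)" for x
  have d_abs: "d (abs_rep_alg p) = \<delta> p" for p
  proof -
    have "rep_rep_alg (abs_rep_alg p) - p \<in> generated_ideal rep_relators"
      by (rule Quotient3_rep_abs[OF Quotient3_rep_alg]) (simp add: ideal_zero)
    from ideal[OF this] show ?thesis
      by (simp add: d_def lins)
  qed
  have "derivation d"
  proof (intro derivationI clinearI)
    fix x y :: "('a, 'm) rep_alg" and c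
    obtain p q where x: "x = abs_rep_alg p" and y: "y = abs_rep_alg q"
      by (metis rep_alg_exhaust)
    show "d (x + y) = d x + d y" "d (c *\<^sub>C x) = c *\<^sub>C d x"
      by (simp_all add: x y d_abs lins flip: clinear_add[OF abs_rep_alg_linear] clinear_scaleC[OF abs_rep_alg_linear])
    show "d (x * y) = x * d y + d x * y"
      by (simp add: x y d_abs leibniz flip: abs_rep_alg_mult)
  qed
  moreover have "d (rep_gen a \<alpha>) = f a \<alpha>" for a \<alpha>
    by (simp add: rep_gen_eq d_abs var)
  ultimately show ?thesis
    by blast
qed

section \<open>The bracket on generators as a contraction\<close>

text \<open>The legs of \<open>t\<close> receive the outer legs of the triple coproduct of \<open>\<beta>\<close>, and \<open>\<phi>\<close> absorbs the middle
  one.  For \<open>\<phi> = \<nu> \<alpha>\<close> and \<open>t = D (a \<otimes> b)\<close> this is the bracket of \<open>a\<^sub>\<alpha>\<close> and \<open>b\<^sub>\<beta>\<close>.\<close>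

definition contraction ::
  "('m::coalgebra \<Rightarrow> complex) \<Rightarrow> ('a::complex_algebra_1, 'a) tensor \<Rightarrow> 'm \<Rightarrow> ('a, 'm) rep_alg" where
  "contraction \<phi> t \<beta> = sweedler (\<lambda>\<beta>1 \<beta>'. sweedler (\<lambda>\<beta>2 \<beta>3.
     \<phi> \<beta>2 *\<^sub>C tensor_lift (\<lambda>x y. rep_gen x \<beta>1 * rep_gen y \<beta>3) t) \<beta>') \<beta>"

lemma rep_gen_product_cbilinear:
  "cbilinear (\<lambda>x y. rep_gen x \<alpha> * rep_gen y \<beta>)"
  by (intro clin)

lemma contraction_linear:
  assumes [THEN clinear_compose, clin]: "clinear \<phi>"
  shows "clinear (contraction \<phi> t)" "clinear (\<lambda>t. contraction \<phi> t \<beta>)"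
proof -
  show "clinear (contraction \<phi> t)"
    unfolding contraction_def by (intro clin)
  show "clinear (\<lambda>t. contraction \<phi> t \<beta>)"
    unfolding contraction_def
    by (intro clinear_tensor_lift_integrand clinear_scale_const clinear_tensor_lift
        rep_gen_product_cbilinear)
qed

lemma contraction_functional_linear:
  assumes "cbilinear \<nu>"
  shows "clinear (\<lambda>\<alpha>. contraction (\<nu> \<alpha>) t \<beta>)"
  unfolding contraction_def using assms
  by (intro clinear_tensor_lift_integrand clinear_scale_vector) (simp add: cbilinear_def)

text \<open>Multiplying the left leg by \<open>b\<close> on the left splits the first leg of \<open>\<beta>\<close>; coassociativity lets
  the outermost leg be split off first, and it carries \<open>b\<close> out of the contraction.\<close>

lemma contraction_mult_left:
  assumes [THEN clinear_compose, clin]: "clinear \<phi>"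
  shows "contraction \<phi> ((b \<otimes> 1) * t) \<beta> = sweedler (\<lambda>\<beta>1 \<beta>2. rep_gen b \<beta>1 * contraction \<phi> t \<beta>2) \<beta>"
proof -
  let ?g = "\<lambda>u v \<gamma>. sweedler (\<lambda>\<beta>2 \<beta>3. \<phi> \<beta>2 *\<^sub>C
    tensor_lift (\<lambda>x y. rep_gen b u * (rep_gen x v * rep_gen y \<beta>3)) t) \<gamma>"
  have "contraction \<phi> ((b \<otimes> 1) * t) \<beta> = sweedler (\<lambda>\<beta>1 \<gamma>. sweedler (\<lambda>\<beta>2 \<beta>3. \<phi> \<beta>2 *\<^sub>C
      tensor_lift (\<lambda>x y. sweedler (\<lambda>u v. rep_gen b u * (rep_gen x v * rep_gen y \<beta>3)) \<beta>1) t) \<gamma>) \<beta>"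
    by (simp add: contraction_def tensor_lift_mult_left rep_gen_product_cbilinear rep_gen_mult
        tensor_lift_times_right mult.assoc)
  also have "\<dots> = sweedler (\<lambda>\<beta>1 \<gamma>. sweedler (\<lambda>\<beta>2 \<beta>3. sweedler (\<lambda>u v. \<phi> \<beta>2 *\<^sub>C
      tensor_lift (\<lambda>x y. rep_gen b u * (rep_gen x v * rep_gen y \<beta>3)) t) \<beta>1) \<gamma>) \<beta>"
    by (subst tensor_lift_swap[of _ "comult _" t]) (simp add: tensor_lift_scaleC)
  also have "\<dots> = sweedler (\<lambda>\<beta>1 \<gamma>. sweedler (\<lambda>u v. ?g u v \<gamma>) \<beta>1) \<beta>"
    by (subst tensor_lift_swap) (rule refl)
  also have "\<dots> = sweedler (\<lambda>u \<gamma>'. sweedler (\<lambda>v \<gamma>. ?g u v \<gamma>) \<gamma>') \<beta>"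
    by (rule sweedler_coassoc) (intro clin)+
  also have "\<dots> = sweedler (\<lambda>\<beta>1 \<beta>2. rep_gen b \<beta>1 * contraction \<phi> t \<beta>2) \<beta>"
    by (simp add: contraction_def tensor_lift_times_left tensor_lift_scaleC mult_scaleC_right)
  finally show ?thesis .
qed

text \<open>The mirror image of the previous lemma.  The last leg now lies two coproducts deep, so
  coassociativity is used twice to bring it to the outside.\<close>

lemma contraction_mult_right:
  assumes [THEN clinear_compose, clin]: "clinear \<phi>"
  shows "contraction \<phi> (t * (1 \<otimes> c)) \<beta> = sweedler (\<lambda>\<beta>1 \<beta>2. contraction \<phi> t \<beta>1 * rep_gen c \<beta>2) \<beta>"
proof -
  let ?h = "\<lambda>\<beta>1 \<beta>2 u v. \<phi> \<beta>2 *\<^sub>C tensor_lift (\<lambda>x y. rep_gen x \<beta>1 * (rep_gen y u * rep_gen c v)) t"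
  have "contraction \<phi> (t * (1 \<otimes> c)) \<beta> = sweedler (\<lambda>\<beta>1 \<gamma>. sweedler (\<lambda>\<beta>2 \<beta>3. \<phi> \<beta>2 *\<^sub>C
      tensor_lift (\<lambda>x y. sweedler (\<lambda>u v. rep_gen x \<beta>1 * (rep_gen y u * rep_gen c v)) \<beta>3) t) \<gamma>) \<beta>"
    by (simp add: contraction_def tensor_lift_mult_right rep_gen_product_cbilinear rep_gen_mult
        tensor_lift_times_left)
  also have "\<dots> = sweedler (\<lambda>\<beta>1 \<gamma>. sweedler (\<lambda>\<beta>2 \<beta>3. sweedler (\<lambda>u v. ?h \<beta>1 \<beta>2 u v) \<beta>3) \<gamma>) \<beta>"
    by (subst tensor_lift_swap[of _ "comult _" t]) (simp add: tensor_lift_scaleC)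
  also have "\<dots> = sweedler (\<lambda>\<beta>1 \<gamma>. sweedler (\<lambda>\<gamma>' v. sweedler (\<lambda>\<beta>2 u. ?h \<beta>1 \<beta>2 u v) \<gamma>') \<gamma>) \<beta>"
    by (subst sweedler_coassoc) (intro clin | rule refl)+
  also have "\<dots> = sweedler (\<lambda>\<gamma> v. sweedler (\<lambda>\<beta>1 \<gamma>'. sweedler (\<lambda>\<beta>2 u. ?h \<beta>1 \<beta>2 u v) \<gamma>') \<gamma>) \<beta>"
    by (rule sweedler_coassoc[symmetric]) (intro clin)+
  also have "\<dots> = sweedler (\<lambda>\<beta>1 \<beta>2. contraction \<phi> t \<beta>1 * rep_gen c \<beta>2) \<beta>"
    by (simp add: contraction_def tensor_lift_times_right tensor_lift_scaleC mult_scaleC_left mult.assoc)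
  finally show ?thesis .
qed

text \<open>The two sides of the balance condition are tensors of two coalgebra elements; here they become
  the indices of the legs of \<open>t\<close>.  The reversed order of the legs on one side is accounted for by the
  flip and by commutativity of the representation algebra.\<close>

lemma balanced_contraction:
  assumes "balanced_form \<nu>"
  shows "contraction (\<nu> \<alpha>) t \<beta> = contraction (\<nu> \<beta>) (tensor_flip t) \<alpha>"
proof -
  let ?h = "\<lambda>\<gamma> \<delta>. tensor_lift (\<lambda>x y. rep_gen x \<gamma> * rep_gen y \<delta>) t"
  have [THEN clinear_compose, clin]: "clinear (\<nu> \<alpha>)" for \<alpha>
    using assms by (simp add: balanced_form_def cbilinear_def)
  have h: "cbilinear ?h"
    by (intro clin)
  note lin = tensor_lift_linear[OF clinear_tensor_lift[OF h]] clinear_scaleC[OF clinear_tensor_lift[OF h]]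
    tensor_lift_pure[OF h]
  have "tensor3_lift (\<lambda>\<beta>1 \<beta>2 \<beta>3. \<nu> \<alpha> \<beta>2 *\<^sub>C (\<beta>1 \<otimes> \<beta>3)) (comult3 \<beta>) =
      sweedler (\<lambda>\<beta>1 \<gamma>. sweedler (\<lambda>\<beta>2 \<beta>3. \<nu> \<alpha> \<beta>2 *\<^sub>C (\<beta>1 \<otimes> \<beta>3)) \<gamma>) \<beta>"
    by (rule comult3_lift) (intro clin)+
  moreover have "tensor3_lift (\<lambda>\<alpha>1 \<alpha>2 \<alpha>3. \<nu> \<beta> \<alpha>2 *\<^sub>C (\<alpha>3 \<otimes> \<alpha>1)) (comult3 \<alpha>) =
      sweedler (\<lambda>\<alpha>1 \<gamma>. sweedler (\<lambda>\<alpha>2 \<alpha>3. \<nu> \<beta> \<alpha>2 *\<^sub>C (\<alpha>3 \<otimes> \<alpha>1)) \<gamma>) \<alpha>"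
    by (rule comult3_lift) (intro clin)+
  ultimately have "sweedler (\<lambda>\<beta>1 \<gamma>. sweedler (\<lambda>\<beta>2 \<beta>3. \<nu> \<alpha> \<beta>2 *\<^sub>C (\<beta>1 \<otimes> \<beta>3)) \<gamma>) \<beta> =
      sweedler (\<lambda>\<alpha>1 \<gamma>. sweedler (\<lambda>\<alpha>2 \<alpha>3. \<nu> \<beta> \<alpha>2 *\<^sub>C (\<alpha>3 \<otimes> \<alpha>1)) \<gamma>) \<alpha>"
    using assms by (simp add: balanced_form_def)
  from arg_cong[OF this, of "tensor_lift ?h"] show ?thesis
    by (simp add: lin contraction_def tensor_lift_flip rep_gen_product_cbilinear mult.commute)
qed

section \<open>Existence and uniqueness of the induced bracket\<close>

lemma is_induced_bracket_iff:
  assumes "balanced_form \<nu>"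
  shows "is_induced_bracket D \<nu> B \<longleftrightarrow> biderivation B \<and>
    (\<forall>a b \<alpha> \<beta>. B (rep_gen a \<alpha>) (rep_gen b \<beta>) = contraction (\<nu> \<alpha>) (D (a \<otimes> b)) \<beta>)"
proof -
  have [THEN clinear_compose, clin]: "clinear (\<nu> \<alpha>)" for \<alpha>
    using assms by (simp add: balanced_form_def cbilinear_def)
  have "tensor3_lift (\<lambda>\<beta>1 \<beta>2 \<beta>3. \<nu> \<alpha> \<beta>2 *\<^sub>C
      tensor_lift (\<lambda>x y. rep_gen x \<beta>1 * rep_gen y \<beta>3) (D (a \<otimes> b))) (comult3 \<beta>) =
      contraction (\<nu> \<alpha>) (D (a \<otimes> b)) \<beta>" for a b \<alpha> \<beta>
    unfolding contraction_def by (rule comult3_lift) (intro clin)+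
  then show ?thesis
    by (simp add: is_induced_bracket_def)
qed

lemma induced_bracket_unique:
  assumes "balanced_form \<nu>" "is_induced_bracket D \<nu> B" "is_induced_bracket D \<nu> C"
  shows "B = C"
proof (intro ext)
  fix x y
  note B = assms(2)[unfolded is_induced_bracket_iff[OF assms(1)]]
  note C = assms(3)[unfolded is_induced_bracket_iff[OF assms(1)]]
  note dB = biderivationD[OF B[THEN conjunct1]] and dC = biderivationD[OF C[THEN conjunct1]]
  have "B (rep_gen a \<alpha>) y = C (rep_gen a \<alpha>) y" for a \<alpha>
    by (rule derivation_eq_on_generators[OF dB(1) dC(1)]) (simp add: B C)
  then show "B x y = C x y"
    by (rule derivation_eq_on_generators[OF dB(2) dC(2)])
qed

text \<open>With the second argument a generator \<open>b\<^sub>\<beta>\<close>, the prescribed values extend to a derivation \<open>E b \<beta>\<close> in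
  the first argument.  For fixed \<open>x\<close>, the function \<open>E b \<beta> x\<close> of \<open>b\<close> and \<open>\<beta>\<close> is again bilinear with the
  Leibniz rule, since both sides of each identity are derivations in \<open>x\<close> and agree on generators;
  hence it extends to a derivation in the second argument.  That the result is still a derivation
  in \<open>x\<close> is checked on generators in the second argument.\<close>

lemma biderivation_extension:
  fixes F :: "'a::complex_algebra_1 \<Rightarrow> 'm::coalgebra \<Rightarrow> 'a \<Rightarrow> 'm \<Rightarrow> ('a, 'm) rep_alg"
  assumes bil1: "\<And>b \<beta>. cbilinear (\<lambda>a \<alpha>. F a \<alpha> b \<beta>)"
    and bil2: "\<And>a \<alpha>. cbilinear (\<lambda>b \<beta>. F a \<alpha> b \<beta>)"
    and mult1: "\<And>a a' \<alpha> b \<beta>. F (a * a') \<alpha> b \<beta> =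
      sweedler (\<lambda>\<alpha>1 \<alpha>2. rep_gen a \<alpha>1 * F a' \<alpha>2 b \<beta> + F a \<alpha>1 b \<beta> * rep_gen a' \<alpha>2) \<alpha>"
    and mult2: "\<And>a \<alpha> b b' \<beta>. F a \<alpha> (b * b') \<beta> =
      sweedler (\<lambda>\<beta>1 \<beta>2. rep_gen b \<beta>1 * F a \<alpha> b' \<beta>2 + F a \<alpha> b \<beta>1 * rep_gen b' \<beta>2) \<beta>"
  shows "\<exists>B. biderivation B \<and> (\<forall>a \<alpha> b \<beta>. B (rep_gen a \<alpha>) (rep_gen b \<beta>) = F a \<alpha> b \<beta>)"
proof -
  have "\<exists>d. derivation d \<and> (\<forall>a \<alpha>. d (rep_gen a \<alpha>) = F a \<alpha> b \<beta>)" for b \<beta>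
    by (rule rep_alg_derivation_extension) (rule bil1 mult1)+
  then obtain E where E: "\<And>b \<beta>. derivation (E b \<beta>)"
    and E_gen: "\<And>a \<alpha> b \<beta>. E b \<beta> (rep_gen a \<alpha>) = F a \<alpha> b \<beta>"
    by metis
  have "\<exists>d. derivation d \<and> (\<forall>b \<beta>. d (rep_gen b \<beta>) = E b \<beta> x)" for x
  proof (rule rep_alg_derivation_extension)
    show "cbilinear (\<lambda>b \<beta>. E b \<beta> x)"
    proof (rule cbilinearI)
      fix b b' \<beta> \<beta>' c
      show "E b (\<beta> + \<beta>') x = E b \<beta> x + E b \<beta>' x"
        by (rule derivation_eq_on_generators[where d = "E b (\<beta> + \<beta>')"])
          ((intro E derivation_add)+, simp add: E_gen cbilinearD[OF bil2])
      show "E (b + b') \<beta> x = E b \<beta> x + E b' \<beta> x"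
        by (rule derivation_eq_on_generators[where d = "E (b + b') \<beta>"])
          ((intro E derivation_add)+, simp add: E_gen cbilinearD[OF bil2])
      show "E b (c *\<^sub>C \<beta>) x = c *\<^sub>C E b \<beta> x"
        by (rule derivation_eq_on_generators[where d = "E b (c *\<^sub>C \<beta>)"])
          ((intro E derivation_scaleC)+, simp add: E_gen cbilinearD[OF bil2])
      show "E (c *\<^sub>C b) \<beta> x = c *\<^sub>C E b \<beta> x"
        by (rule derivation_eq_on_generators[where d = "E (c *\<^sub>C b) \<beta>"])
          ((intro E derivation_scaleC)+, simp add: E_gen cbilinearD[OF bil2])
    qed
    show "E (b * b') \<beta> x =
        sweedler (\<lambda>\<beta>1 \<beta>2. rep_gen b \<beta>1 * E b' \<beta>2 x + E b \<beta>1 x * rep_gen b' \<beta>2) \<beta>" for b b' \<beta>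
      by (rule derivation_eq_on_generators)
        ((intro E derivation_tensor_lift derivation_add derivation_mult_const)+, simp add: E_gen mult2)
  qed
  then obtain B where B: "\<And>x. derivation (B x)" and B_gen: "\<And>b \<beta> x. B x (rep_gen b \<beta>) = E b \<beta> x"
    by metis
  have "derivation (\<lambda>x. B x y)" for y
  proof (intro derivationI clinearI)
    fix x x' c
    show "B (x + x') y = B x y + B x' y"
      by (rule derivation_eq_on_generators)
        ((intro B derivation_add)+, simp add: B_gen clinear_add[OF derivation_linear[OF E]])
    show "B (c *\<^sub>C x) y = c *\<^sub>C B x y"
      by (rule derivation_eq_on_generators)
        ((intro B derivation_scaleC)+, simp add: B_gen clinear_scaleC[OF derivation_linear[OF E]])
    show "B (x * x') y = x * B x' y + B x y * x'"
      by (rule derivation_eq_on_generators)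
        ((intro B derivation_add derivation_mult_const)+, simp add: B_gen derivation_mult[OF E])
  qed
  then have "biderivation B"
    using B by (intro biderivationI)
  then show ?thesis
    using B_gen E_gen by auto
qed

text \<open>The Leibniz rule in the second slot follows from \<open>D_right\<close>.  For the first slot the
  balance condition moves the coproduct to \<open>\<alpha>\<close>; the flip of the right-hand side of \<open>D_left\<close> then has
  the shape of the right-hand side of \<open>D_right\<close>.\<close>

lemma induced_bracket_exists:
  fixes D :: "('a::complex_algebra_1, 'a) tensor \<Rightarrow> ('a, 'a) tensor"
    and \<nu> :: "'m::coalgebra \<Rightarrow> 'm \<Rightarrow> complex"
  assumes D: "clinear D"
    and D_right: "\<And>a b c. D (a \<otimes> (b * c)) = (b \<otimes> 1) * D (a \<otimes> c) + D (a \<otimes> b) * (1 \<otimes> c)"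
    and D_left: "\<And>a b c. D ((a * b) \<otimes> c) = (1 \<otimes> a) * D (b \<otimes> c) + D (a \<otimes> c) * (b \<otimes> 1)"
    and \<nu>: "balanced_form \<nu>"
  shows "\<exists>B. is_induced_bracket D \<nu> B"
proof -
  have bil: "cbilinear \<nu>" and lin: "clinear (\<nu> \<alpha>)" for \<alpha>
    using \<nu> by (simp_all add: balanced_form_def cbilinear_def)
  note con = contraction_linear[OF lin]
  note con_add = clinear_add[OF con(2)]
  note compose = clinear_compose[OF con(2)] clinear_compose[OF D]
  let ?F = "\<lambda>a \<alpha> b \<beta>. contraction (\<nu> \<alpha>) (D (a \<otimes> b)) \<beta>"
  have "\<exists>B. biderivation B \<and> (\<forall>a \<alpha> b \<beta>. B (rep_gen a \<alpha>) (rep_gen b \<beta>) = ?F a \<alpha> b \<beta>)"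
  proof (rule biderivation_extension)
    fix a a' b b' :: 'a and \<alpha> \<beta> :: 'm
    show "cbilinear (\<lambda>a \<alpha>. ?F a \<alpha> b \<beta>)"
      by (intro cbilinear_intro contraction_functional_linear[OF bil] compose clin)
    show "cbilinear (\<lambda>b \<beta>. ?F a \<alpha> b \<beta>)"
      by (intro cbilinear_intro con(1) compose clin)
    show "?F a \<alpha> (b * b') \<beta> =
        sweedler (\<lambda>\<beta>1 \<beta>2. rep_gen b \<beta>1 * ?F a \<alpha> b' \<beta>2 + ?F a \<alpha> b \<beta>1 * rep_gen b' \<beta>2) \<beta>"
      by (simp add: D_right con_add contraction_mult_left[OF lin] contraction_mult_right[OF lin]
          tensor_lift_add)
    have "?F (a * a') \<alpha> b \<beta> =
        contraction (\<nu> \<beta>) ((a \<otimes> 1) * tensor_flip (D (a' \<otimes> b)) + tensor_flip (D (a \<otimes> b)) * (1 \<otimes> a')) \<alpha>"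
      by (simp add: balanced_contraction[OF \<nu>, of \<alpha>] D_left tensor_flip_mult tensor_flip_pure
          clinear_add[OF tensor_flip_linear])
    also have "\<dots> = sweedler (\<lambda>\<alpha>1 \<alpha>2. rep_gen a \<alpha>1 * contraction (\<nu> \<beta>) (tensor_flip (D (a' \<otimes> b))) \<alpha>2 +
        contraction (\<nu> \<beta>) (tensor_flip (D (a \<otimes> b))) \<alpha>1 * rep_gen a' \<alpha>2) \<alpha>"
      by (simp add: con_add contraction_mult_left[OF lin] contraction_mult_right[OF lin] tensor_lift_add)
    finally show "?F (a * a') \<alpha> b \<beta> =
        sweedler (\<lambda>\<alpha>1 \<alpha>2. rep_gen a \<alpha>1 * ?F a' \<alpha>2 b \<beta> + ?F a \<alpha>1 b \<beta> * rep_gen a' \<alpha>2) \<alpha>"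
      by (simp add: balanced_contraction[OF \<nu>, of _ _ \<beta>])
  qed
  then show ?thesis
    by (simp add: is_induced_bracket_iff[OF \<nu>]) metis
qed

lemma is_induced_bracket_induced_bracket:
  assumes "modified_double_poisson D" "balanced_form \<nu>"
  shows "is_induced_bracket D \<nu> (induced_bracket D \<nu>)"
proof -
  have "\<exists>B. is_induced_bracket D \<nu> B"
    using assms by (intro induced_bracket_exists) (auto simp: modified_double_poisson_def)
  then show ?thesis
    unfolding induced_bracket_def using induced_bracket_unique[OF assms(2)] by (metis theI')
qed

section \<open>The trace element\<close>

text \<open>The counit removes the middle leg, and the remaining two recombine by \<open>x\<^sub>\<beta>\<^sub>1 y\<^sub>\<beta>\<^sub>2 = (xy)\<^sub>\<beta>\<close>.\<close>

lemma contraction_counit: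
  "contraction counit t \<beta> = rep_gen (tensor_lift (*) t) \<beta>"
proof -
  let ?h = "\<lambda>\<gamma> \<delta>. tensor_lift (\<lambda>x y. rep_gen x \<gamma> * rep_gen y \<delta>) t"
  have h: "clinear (?h \<gamma>)" for \<gamma>
    by (intro clin)
  have counit: "sweedler (\<lambda>\<beta>2 \<beta>3. counit \<beta>2 *\<^sub>C ?h \<gamma> \<beta>3) \<delta> = ?h \<gamma> \<delta>" for \<gamma> \<delta>
    using arg_cong[OF counit_left[of \<delta>], of "?h \<gamma>"]
    by (simp add: tensor_lift_linear[OF h] clinear_scaleC[OF h])
  have "contraction counit t \<beta> = sweedler ?h \<beta>"
    unfolding contraction_def counit ..
  also have "\<dots> = tensor_lift (\<lambda>x y. rep_gen (x * y) \<beta>) t"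
    by (subst tensor_lift_swap) (simp add: rep_gen_mult)
  also have "\<dots> = rep_gen (tensor_lift (*) t) \<beta>"
    by (rule tensor_lift_linear[symmetric]) (intro clin)
  finally show ?thesis .
qed

text \<open>This is the symmetry of the coproduct of \<open>\<tau>\<close>: at \<open>\<alpha> = \<beta> = \<tau>\<close> the balance condition compares the
  contraction of \<open>a \<otimes> b\<close> along the counit with that of \<open>b \<otimes> a\<close>.\<close>

lemma rep_gen_commutator_trace:
  fixes \<nu> :: "'m::coalgebra \<Rightarrow> 'm \<Rightarrow> complex"
  assumes \<nu>: "balanced_form \<nu>" and \<tau>: "trace_element \<nu> \<tau>"
  shows "rep_gen (a * b) \<tau> = rep_gen (b * a) \<tau>"
proof -
  have \<nu>\<tau>: "\<nu> \<tau> = counit"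
    using \<tau> by (auto simp: trace_element_def)
  have mult: "cbilinear ((*) :: 'a \<Rightarrow> 'a \<Rightarrow> 'a)"
    by (intro clin)
  show ?thesis
    using balanced_contraction[OF \<nu>, of \<tau> "a \<otimes> b" \<tau>]
    by (simp add: \<nu>\<tau> contraction_counit tensor_flip_pure tensor_lift_pure[OF mult])
qed

lemma rep_gen_trace_commutators:
  assumes "balanced_form \<nu>" "trace_element \<nu> \<tau>"
    and x: "x \<in> cvec.span {a * b - b * a | a b. True}"
  shows "rep_gen x \<tau> = 0"
proof -
  have lin: "clinear (\<lambda>x. rep_gen x \<tau>)"
    by (intro clin)
  show ?thesis
    using x
    by (induction rule: cvec.span_induct_alt)
      (auto simp: clinear_zero[OF lin] clinear_add[OF lin] clinear_scaleC[OF lin] clinear_diff[OF lin]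
        rep_gen_commutator_trace[OF assms(1,2)])
qed

theorem corollary35:
  fixes D :: "('a::complex_algebra_1, 'a) tensor \<Rightarrow> ('a, 'a) tensor"
    and \<nu> :: "'m::coalgebra \<Rightarrow> 'm \<Rightarrow> complex"
    and \<tau> :: 'm
  assumes "modified_double_poisson D"
    and "balanced_form \<nu>"
    and "trace_element \<nu> \<tau>"
  shows "poisson_bracket_on (trace_algebra \<tau>) (induced_bracket D \<nu>)"
proof -
  let ?B = "induced_bracket D \<nu>" and ?m = "mult_bracket D"
  have lin: "clinear (\<lambda>x. rep_gen x \<tau>)"
    by (intro clin)
  have B: "biderivation ?B"
    and gen: "?B (rep_gen a \<alpha>) (rep_gen b \<beta>) = contraction (\<nu> \<alpha>) (D (a \<otimes> b)) \<beta>" for a b \<alpha> \<beta>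
    using is_induced_bracket_induced_bracket[OF assms(1,2)]
    by (auto simp: is_induced_bracket_iff[OF assms(2)])
  have \<nu>\<tau>: "\<nu> \<tau> = counit"
    using assms(3) by (auto simp: trace_element_def)
  have trace: "?B (rep_gen a \<tau>) (rep_gen b \<tau>) = rep_gen (?m a b) \<tau>" for a b
    by (simp add: gen \<nu>\<tau> contraction_counit mult_bracket_def)
  have skew: "rep_gen (?m a b) \<tau> = - rep_gen (?m b a) \<tau>" for a b
  proof -
    have "rep_gen (?m a b + ?m b a) \<tau> = 0"
      using assms(1) by (intro rep_gen_trace_commutators[OF assms(2,3)]) (simp add: modified_double_poisson_def)
    then show ?thesis
      by (simp add: clinear_add[OF lin] eq_neg_iff_add_eq_0)
  qed
  have neg: "?B x (- y) = - ?B x y" for x y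
    by (rule clinear_uminus[OF derivation_linear[OF biderivationD(1)[OF B]]])
  show ?thesis
    unfolding trace_algebra_def
  proof (rule poisson_bracket_on_hull[OF B])
    fix x y z :: "('a, 'm) rep_alg"
    assume "x \<in> {rep_gen a \<tau> | a. True}" "y \<in> {rep_gen a \<tau> | a. True}"
    then obtain a b where x: "x = rep_gen a \<tau>" and y: "y = rep_gen b \<tau>"
      by blast
    show "?B x y \<in> subalgebra hull {rep_gen a \<tau> | a. True}"
      by (rule hull_inc) (auto simp: x y trace)
    show "?B x y = - ?B y x"
      unfolding x y trace by (rule skew)
    assume "z \<in> {rep_gen a \<tau> | a. True}"
    then obtain c where z: "z = rep_gen c \<tau>"
      by blast
    have "?m a (?m b c) - ?m b (?m a c) = ?m (?m a b) c"
      using assms(1) by (simp add: modified_double_poisson_def)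
    then have jacobi: "rep_gen (?m a (?m b c)) \<tau> - rep_gen (?m b (?m a c)) \<tau> = rep_gen (?m (?m a b) c) \<tau>"
      by (simp flip: clinear_diff[OF lin])
    have "?B x (?B y z) = rep_gen (?m a (?m b c)) \<tau>"
      by (simp only: x y z trace)
    moreover have "?B y (?B z x) = - rep_gen (?m b (?m a c)) \<tau>"
      by (simp only: x y z trace skew[of c a] neg)
    moreover have "?B z (?B x y) = - rep_gen (?m (?m a b) c) \<tau>"
      by (simp only: x y z trace skew[of c "?m a b"])
    ultimately show "?B x (?B y z) + ?B y (?B z x) + ?B z (?B x y) = 0"
      by (simp only: jacobi[symmetric]) simp
  qed
qed

end
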